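(* Let $(G,X,H)$ be an A/QI triple, and suppose that $G$ is finitely generated. Then $H$ is stable in $G$.
   Context: A hyperbolic space is a Gromov hyperbolic geodesic metric space $(X,d)$; all actions are by isometries. For $Y\subseteq X$, an action $G\curvearrowright X$ is acylindrical along $Y$ if for every $\varepsilon\ge 0$ there are $R>0$ and $M>0$ so that, whenever $x,y\in Y$ satisfy $d(x,y)\ge R$, $\#\{g\in G\mid d(gx,x)\le\varepsilon \text{ and } d(gy,y)\le\varepsilon\}\le M$. For $H<G$, the action is acylindrical along $H$ if it is acylindrical along $Hx$ for some (equivalently any) $x\in X$. A finitely generated subgroup $H<G$ is quasi-isometrically embedded by the action if, for some (equivalently any) $x\in X$, $h\mapsto hx$ is a quasi-isometric embedding of $H$ (with a word metric) into $X$. An A/QI triple $(G,X,H)$ consists of a hyperbolic space $X$ and an action $G\curvearrowright X$ which is acylindrical along a finitely generated infinite subgroup $H<G$ that is quasi-isometrically embedded by the action. For $\tau\ge 1$, a $\tau$-quasi-geodesic in a metric space $Z$ is a map $\gamma\colon I\to Z$ from an interval $I\subseteq\mathbb R$ with $\tau^{-1}|s-t|-\tau\le d_Z(\gamma(s),\gamma(t))\le\tau|s-t|+\tau$ for all $s,t\in I$. Stability: let $G$ be a finitely generated group. A finitely generated subgroup $H$ of $G$ is stable if it is undistorted (the inclusion is a quasi-isometric embedding for word metrics) and for some (equivalently, any) finite generating set $S$ of $G$ and every $\tau\ge1$ there exists $L=L(S,\tau)$ such that whenever $\gamma_1,\gamma_2$ are $\tau$-quasi-geodesics in the Cayley graph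 $\operatorname{Cay}(G,S)$ with the same endpoints in $H$, the Hausdorff distance between $\gamma_1$ and $\gamma_2$ is at most $L$. *)

theory Defs
  imports "HOL-Analysis.Analysis" "HOL-Algebra.Generated_Groups" "HOL-Algebra.Group_Action"
begin

section \<open>Coarse metric geometry\<close>

definition qi_embedding ::
    "'a set \<Rightarrow> ('a \<Rightarrow> 'a \<Rightarrow> real) \<Rightarrow> ('b \<Rightarrow> 'b \<Rightarrow> real) \<Rightarrow> ('a \<Rightarrow> 'b) \<Rightarrow> bool" where
  "qi_embedding A dA dB f \<longleftrightarrow>
     (\<exists>K\<ge>1. \<exists>C\<ge>0. \<forall>a\<in>A. \<forall>b\<in>A.
        dA a b / K - C \<le> dB (f a) (f b) \<and> dB (f a) (f b) \<le> K * dA a b + C)"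

definition quasi_geodesic ::
    "'z set \<Rightarrow> ('z \<Rightarrow> 'z \<Rightarrow> real) \<Rightarrow> real \<Rightarrow> real set \<Rightarrow> (real \<Rightarrow> 'z) \<Rightarrow> bool" where
  "quasi_geodesic Z d \<tau> I \<gamma> \<longleftrightarrow>
     is_interval I \<and> \<gamma> ` I \<subseteq> Z \<and>
     (\<forall>s\<in>I. \<forall>t\<in>I. \<bar>s - t\<bar> / \<tau> - \<tau> \<le> d (\<gamma> s) (\<gamma> t) \<and> d (\<gamma> s) (\<gamma> t) \<le> \<tau> * \<bar>s - t\<bar> + \<tau>)"

text \<open>Extended real valued, so that the distance is infinite when no \<open>r\<close> is admissible.\<close>

definition hausdorff_distance :: "('z \<Rightarrow> 'z \<Rightarrow> real) \<Rightarrow> 'z set \<Rightarrow> 'z set \<Rightarrow> ereal" where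
  "hausdorff_distance d A B =
     Inf {ereal r | r. 0 \<le> r \<and> (\<forall>a\<in>A. \<exists>b\<in>B. d a b \<le> r) \<and> (\<forall>b\<in>B. \<exists>a\<in>A. d b a \<le> r)}"

definition geodesic_space :: "'x::metric_space itself \<Rightarrow> bool" where
  "geodesic_space _ \<longleftrightarrow>
     (\<forall>x y :: 'x. \<exists>c :: real \<Rightarrow> 'x. c 0 = x \<and> c (dist x y) = y \<and>
        (\<forall>s\<in>{0..dist x y}. \<forall>t\<in>{0..dist x y}. dist (c s) (c t) = \<bar>s - t\<bar>))"

definition gromov_product :: "'x::metric_space \<Rightarrow> 'x \<Rightarrow> 'x \<Rightarrow> real" where
  "gromov_product w x y = (dist x w + dist y w - dist x y) / 2"

definition gromov_hyperbolic :: "'x::metric_space itself \<Rightarrow> bool" where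
  "gromov_hyperbolic _ \<longleftrightarrow>
     (\<exists>\<delta>\<ge>0. \<forall>w x y z :: 'x.
        gromov_product w x z \<ge> min (gromov_product w x y) (gromov_product w y z) - \<delta>)"

definition hyperbolic_space :: "'x::metric_space itself \<Rightarrow> bool" where
  "hyperbolic_space T \<longleftrightarrow> geodesic_space T \<and> gromov_hyperbolic T"

section \<open>Finite generation and word metrics\<close>

definition finite_generating_set :: "('g, 'm) monoid_scheme \<Rightarrow> 'g set \<Rightarrow> 'g set \<Rightarrow> bool" where
  "finite_generating_set G H T \<longleftrightarrow> finite T \<and> T \<subseteq> carrier G \<and> generate G T = H"

definition finitely_generated :: "('g, 'm) monoid_scheme \<Rightarrow> 'g set \<Rightarrow> bool" where
  "finitely_generated G H \<longleftrightarrow> (\<exists>T. finite_generating_set G H T)"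

text \<open>The word length is only meaningful on the subgroup generated by \<open>T\<close>.\<close>

definition word_length :: "('g, 'm) monoid_scheme \<Rightarrow> 'g set \<Rightarrow> 'g \<Rightarrow> nat" where
  "word_length G T g =
     (LEAST n. \<exists>ws. length ws = n \<and> set ws \<subseteq> T \<union> m_inv G ` T \<and> foldr (mult G) ws (one G) = g)"

definition word_dist :: "('g, 'm) monoid_scheme \<Rightarrow> 'g set \<Rightarrow> 'g \<Rightarrow> 'g \<Rightarrow> real" where
  "word_dist G T g h = real (word_length G T (inv\<^bsub>G\<^esub> g \<otimes>\<^bsub>G\<^esub> h))"

section \<open>Cayley graphs as metric graphs\<close>

text \<open>
  A graph is given by the set of its cells: the singletons \<open>{v}\<close> for vertices and the pairs
  \<open>{u, v}\<close> for edges. Points of its geometric realization are written in barycentric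
  coordinates, i.e. as functions from vertices to reals.
\<close>

definition closed_cell :: "'v set \<Rightarrow> ('v \<Rightarrow> real) set" where
  "closed_cell e = {p. (\<forall>v. 0 \<le> p v) \<and> (\<forall>v. v \<notin> e \<longrightarrow> p v = 0) \<and> (\<Sum>v\<in>e. p v) = 1}"

definition graph_points :: "'v set set \<Rightarrow> ('v \<Rightarrow> real) set" where
  "graph_points \<C> = (\<Union>e\<in>\<C>. closed_cell e)"

definition vertex_point :: "'v \<Rightarrow> 'v \<Rightarrow> real" where
  "vertex_point v = (\<lambda>u. if u = v then 1 else 0)"

text \<open>
  \<open>pl_path \<C> p q l\<close>: there is a piecewise linear path of length \<open>l\<close> from \<open>p\<close> to \<open>q\<close>, where every
  edge is isometric to the unit interval. On an edge \<open>{u, v}\<close> the two summands of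
  \<open>(\<Sum>x\<in>{u, v}. \<bar>q x - r x\<bar>) / 2\<close> agree, so this is \<open>\<bar>q u - r u\<bar>\<close>.
\<close>

inductive pl_path :: "'v set set \<Rightarrow> ('v \<Rightarrow> real) \<Rightarrow> ('v \<Rightarrow> real) \<Rightarrow> real \<Rightarrow> bool"
  for \<C> where
  refl: "p \<in> graph_points \<C> \<Longrightarrow> pl_path \<C> p p 0"
| step: "\<lbrakk>pl_path \<C> p q l; e \<in> \<C>; q \<in> closed_cell e; r \<in> closed_cell e\<rbrakk>
          \<Longrightarrow> pl_path \<C> p r (l + (\<Sum>x\<in>e. \<bar>q x - r x\<bar>) / 2)"

definition graph_dist :: "'v set set \<Rightarrow> ('v \<Rightarrow> real) \<Rightarrow> ('v \<Rightarrow> real) \<Rightarrow> real" where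
  "graph_dist \<C> p q = Inf {l. pl_path \<C> p q l}"

text \<open>
  The Cayley graph is taken as a simple graph: if \<open>\<one> \<in> S\<close> this contributes no loop, and
  \<open>s, inv s \<in> S\<close> give one edge.
\<close>

definition cayley_cells :: "('g, 'm) monoid_scheme \<Rightarrow> 'g set \<Rightarrow> 'g set set" where
  "cayley_cells G S =
     {{g} | g. g \<in> carrier G} \<union> {{g, g \<otimes>\<^bsub>G\<^esub> s} | g s. g \<in> carrier G \<and> s \<in> S}"

definition cayley_points :: "('g, 'm) monoid_scheme \<Rightarrow> 'g set \<Rightarrow> ('g \<Rightarrow> real) set" where
  "cayley_points G S = graph_points (cayley_cells G S)"

definition cayley_dist ::
    "('g, 'm) monoid_scheme \<Rightarrow> 'g set \<Rightarrow> ('g \<Rightarrow> real) \<Rightarrow> ('g \<Rightarrow> real) \<Rightarrow> real" where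
  "cayley_dist G S = graph_dist (cayley_cells G S)"

section \<open>A/QI triples\<close>

definition isometric_action ::
    "('g, 'm) monoid_scheme \<Rightarrow> ('g \<Rightarrow> 'x::metric_space \<Rightarrow> 'x) \<Rightarrow> bool" where
  "isometric_action G \<phi> \<longleftrightarrow>
     group_action G UNIV \<phi> \<and> (\<forall>g\<in>carrier G. \<forall>x y. dist (\<phi> g x) (\<phi> g y) = dist x y)"

definition acylindrical_along_set ::
    "('g, 'm) monoid_scheme \<Rightarrow> ('g \<Rightarrow> 'x::metric_space \<Rightarrow> 'x) \<Rightarrow> 'x set \<Rightarrow> bool" where
  "acylindrical_along_set G \<phi> Y \<longleftrightarrow>
     (\<forall>\<epsilon>\<ge>0::real. \<exists>R>0::real. \<exists>M>0::nat. \<forall>x\<in>Y. \<forall>y\<in>Y. dist x y \<ge> R \<longrightarrow>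
        finite {g \<in> carrier G. dist (\<phi> g x) x \<le> \<epsilon> \<and> dist (\<phi> g y) y \<le> \<epsilon>} \<and>
        card {g \<in> carrier G. dist (\<phi> g x) x \<le> \<epsilon> \<and> dist (\<phi> g y) y \<le> \<epsilon>} \<le> M)"

definition acylindrical_along_subgroup ::
    "('g, 'm) monoid_scheme \<Rightarrow> ('g \<Rightarrow> 'x::metric_space \<Rightarrow> 'x) \<Rightarrow> 'g set \<Rightarrow> bool" where
  "acylindrical_along_subgroup G \<phi> H \<longleftrightarrow>
     (\<exists>x. acylindrical_along_set G \<phi> ((\<lambda>h. \<phi> h x) ` H))"

definition qi_embedded_by_action ::
    "('g, 'm) monoid_scheme \<Rightarrow> ('g \<Rightarrow> 'x::metric_space \<Rightarrow> 'x) \<Rightarrow> 'g set \<Rightarrow> bool" where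
  "qi_embedded_by_action G \<phi> H \<longleftrightarrow>
     (\<exists>T x. finite_generating_set G H T \<and> qi_embedding H (word_dist G T) dist (\<lambda>h. \<phi> h x))"

text \<open>The metric space of the triple is the whole type \<open>'x\<close>.\<close>

definition AQI_triple ::
    "('g, 'm) monoid_scheme \<Rightarrow> ('g \<Rightarrow> 'x::metric_space \<Rightarrow> 'x) \<Rightarrow> 'g set \<Rightarrow> bool" where
  "AQI_triple G \<phi> H \<longleftrightarrow>
     hyperbolic_space TYPE('x) \<and> isometric_action G \<phi> \<and>
     subgroup H G \<and> finitely_generated G H \<and> infinite H \<and>
     acylindrical_along_subgroup G \<phi> H \<and> qi_embedded_by_action G \<phi> H"

section \<open>Stability\<close>

text \<open>
  Neither notion below depends on the choice of finite generating sets; they are required for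
  all of them.
\<close>

definition undistorted :: "('g, 'm) monoid_scheme \<Rightarrow> 'g set \<Rightarrow> bool" where
  "undistorted G H \<longleftrightarrow>
     (\<forall>S T. finite_generating_set G (carrier G) S \<longrightarrow> finite_generating_set G H T \<longrightarrow>
        qi_embedding H (word_dist G T) (word_dist G S) (\<lambda>h. h))"

definition stable_subgroup :: "('g, 'm) monoid_scheme \<Rightarrow> 'g set \<Rightarrow> bool" where
  "stable_subgroup G H \<longleftrightarrow>
     group G \<and> finitely_generated G (carrier G) \<and>
     subgroup H G \<and> finitely_generated G H \<and> undistorted G H \<and>
     (\<forall>S. finite_generating_set G (carrier G) S \<longrightarrow>
       (\<forall>\<tau>\<ge>1::real. \<exists>L::real. \<forall>\<gamma>1 \<gamma>2 a1 b1 a2 b2.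
          a1 \<le> b1 \<and> a2 \<le> b2 \<and>
          quasi_geodesic (cayley_points G S) (cayley_dist G S) \<tau> {a1..b1} \<gamma>1 \<and>
          quasi_geodesic (cayley_points G S) (cayley_dist G S) \<tau> {a2..b2} \<gamma>2 \<and>
          \<gamma>1 a1 = \<gamma>2 a2 \<and> \<gamma>1 b1 = \<gamma>2 b2 \<and>
          \<gamma>1 a1 \<in> vertex_point ` H \<and> \<gamma>1 b1 \<in> vertex_point ` H \<longrightarrow>
          hausdorff_distance (cayley_dist G S) (\<gamma>1 ` {a1..b1}) (\<gamma>2 ` {a2..b2}) \<le> ereal L))"

end

theory Submission
  imports Defs "HOL-Real_Asymp.Real_Asymp"
begin

text \<open>
  Let \<open>Q = H x\<close> be an orbit of \<open>H\<close> in \<open>X\<close>. It is quasi-isometrically embedded, hence quasiconvex,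
  so a nearly closest point projection to \<open>Q\<close> contracts every ball disjoint from \<open>Q\<close> to a set of
  bounded diameter. Pull the projection back to \<open>G\<close> along the orbit map. A path in \<open>G\<close> that stays
  far from \<open>H\<close> makes arbitrarily slow progress in the projection. While its image is at distance
  at least \<open>\<epsilon>\<close> from \<open>Q\<close>, it progresses at a rate of order \<open>1 / \<epsilon>\<close>. If \<open>g\<close> and \<open>g'\<close> on the path are
  at bounded distance in \<open>G\<close>, and \<open>g x\<close> and \<open>g' x\<close> are \<open>\<epsilon>\<close>-close to points \<open>h x\<close> and \<open>h' x\<close> of \<open>Q\<close>
  far from each other, then acylindricity leaves only finitely many possibilities for \<open>h\<^sup>-\<^sup>1 g\<close>, which
  bounds the distance from \<open>g\<close> to \<open>H\<close>. A quasi-geodesic of \<open>G\<close> with endpoints in \<open>H\<close> would progress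
  at a definite linear rate during a long excursion, so its excursions from \<open>H\<close> are bounded. Its
  image in \<open>X\<close> is then a quasi-geodesic, and the Morse lemma in \<open>X\<close> compares two such images.
\<close>

section \<open>Quasiconvexity and the Morse lemma\<close>

text \<open>The obstacle is that the orbit map from \<open>G\<close> to \<open>X\<close> is merely
  Lipschitz: a path far from \<open>H\<close> in \<open>G\<close> may run close to \<open>Q\<close>
  for a long time, and there contraction of the projection says nothing. Acylindricity bounds the
  progress between two such visits by a constant \<open>R\<close> that depends on the closeness
  \<open>\<epsilon>\<close> but not on the time between them, so \<open>R\<close> becomes a small
  rate once the path is long. The distance \<open>r\<close> from \<open>H\<close> that this requires
  does depend on the length. A long excursion is therefore cut into blocks of one fixed length.

  Hyperbolicity enters only as the four-point inequality. A chain of \<open>n\<close> points costs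
  about \<open>log n\<close> times \<open>\<delta>\<close> in it, whereas a chain of linear length
  that detours around a point at distance \<open>D\<close> would have to pay about \<open>D\<close>;
  this one comparison gives quasiconvexity of the orbit and also the Morse lemma. Quasi-geodesics
  are handled as sequences throughout, so that their possible discontinuity never matters.\<close>

definition geodesic_segment :: "(real \<Rightarrow> 'x::metric_space) \<Rightarrow> 'x \<Rightarrow> 'x \<Rightarrow> bool" where
  "geodesic_segment c x y \<longleftrightarrow> c 0 = x \<and> c (dist x y) = y \<and>
     (\<forall>s\<in>{0..dist x y}. \<forall>t\<in>{0..dist x y}. dist (c s) (c t) = \<bar>s - t\<bar>)"

lemma geodesic_spaceD:
  assumes "geodesic_space TYPE('x::metric_space)"
  obtains c where "geodesic_segment c (x::'x) y"
  using assms unfolding geodesic_space_def geodesic_segment_def by blast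

lemma geodesic_segment_ends:
  assumes "geodesic_segment c x y"
  shows "c 0 = x" "c (dist x y) = y"
  using assms by (auto simp: geodesic_segment_def)

lemma geodesic_segment_dist:
  assumes "geodesic_segment c x y" "s \<in> {0..dist x y}" "t \<in> {0..dist x y}"
  shows "dist (c s) (c t) = \<bar>s - t\<bar>"
  using assms by (simp add: geodesic_segment_def)

lemma continuous_on_geodesic_segment:
  assumes "geodesic_segment c x y"
  shows "continuous_on {0..dist x y} c"
proof (rule continuous_onI)
  fix s e :: real assume "s \<in> {0..dist x y}" "0 < e"
  then show "\<exists>d>0. \<forall>t\<in>{0..dist x y}. dist t s < d \<longrightarrow> dist (c t) (c s) \<le> e"
    using geodesic_segment_dist[OF assms] by (intro exI[of _ e]) (auto simp: dist_real_def)
qed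

definition four_point_hyperbolic :: "real \<Rightarrow> 'x::metric_space itself \<Rightarrow> bool" where
  "four_point_hyperbolic \<delta> _ \<longleftrightarrow> (\<forall>w x y z :: 'x.
     min (gromov_product w x y) (gromov_product w y z) - \<delta> \<le> gromov_product w x z)"

text \<open>Coarse connectedness with control on length. Orbits of \<open>H\<close> obtain such
  chains from geodesic words and quasi-geodesics from their own parametrization, so one criterion
  for quasiconvexity serves both.\<close>

definition linearly_chained :: "real \<Rightarrow> real \<Rightarrow> 'x::metric_space set \<Rightarrow> bool" where
  "linearly_chained \<mu> A Q \<longleftrightarrow> (\<forall>p\<in>Q. \<forall>q\<in>Q. \<exists>n f. f 0 = p \<and> f n = q \<and> (\<forall>i\<le>n. f i \<in> Q) \<and>
     (\<forall>i<n. dist (f i) (f (Suc i)) \<le> \<mu>) \<and> real n \<le> A * (dist p q + 1))"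

definition quasiconvex :: "real \<Rightarrow> 'x::metric_space set \<Rightarrow> bool" where
  "quasiconvex \<sigma> Q \<longleftrightarrow> (\<forall>p\<in>Q. \<forall>q\<in>Q. \<forall>c. geodesic_segment c p q \<longrightarrow>
     (\<forall>t\<in>{0..dist p q}. \<exists>z\<in>Q. dist (c t) z \<le> \<sigma>))"

text \<open>The distance is a parameter because the notion is used for \<open>dist\<close> in the
  hyperbolic space and for word metrics in the group.\<close>

definition discrete_quasi_geodesic :: "('a \<Rightarrow> 'a \<Rightarrow> real) \<Rightarrow> real \<Rightarrow> nat \<Rightarrow> (nat \<Rightarrow> 'a) \<Rightarrow> bool" where
  "discrete_quasi_geodesic d \<kappa> n f \<longleftrightarrow> (\<forall>i\<le>n. \<forall>j\<le>n.
     \<bar>real i - real j\<bar> / \<kappa> - \<kappa> \<le> d (f i) (f j) \<and> d (f i) (f j) \<le> \<kappa> * \<bar>real i - real j\<bar> + \<kappa>)"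

lemma discrete_quasi_geodesicD:
  assumes "discrete_quasi_geodesic d \<kappa> n f" "i \<le> n" "j \<le> n"
  shows "\<bar>real i - real j\<bar> / \<kappa> - \<kappa> \<le> d (f i) (f j)" "d (f i) (f j) \<le> \<kappa> * \<bar>real i - real j\<bar> + \<kappa>"
  using assms by (auto simp: discrete_quasi_geodesic_def)

text \<open>Halving the chain arranges the four-point inequalities in a binary tree of depth
  \<open>k\<close>, so the loss is logarithmic in \<open>n\<close>. The bound on
  \<open>dist (f i) w\<close> serves the trivial chain \<open>n = 0\<close>, which halving also
  produces and whose Gromov product is that distance.\<close>

lemma gromov_product_chain:
  fixes w :: "'x::metric_space"
  assumes hyp: "four_point_hyperbolic \<delta> TYPE('x)" and "0 \<le> \<delta>" and "n \<le> 2 ^ k"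
    and "\<And>i. i \<le> n \<Longrightarrow> b \<le> dist (f i) w"
    and "\<And>i. i < n \<Longrightarrow> b \<le> gromov_product w (f i) (f (Suc i))"
  shows "b - real k * \<delta> \<le> gromov_product w (f 0) (f n)"
  using assms(3-)
proof (induction k arbitrary: n f)
  case 0
  then have "n = 0 \<or> n = 1" by auto
  then show ?case
  proof
    assume "n = 0"
    then show ?case using "0.prems"(2)[of 0] by (simp add: gromov_product_def)
  next
    assume "n = 1"
    then show ?case using "0.prems"(3)[of 0] by simp
  qed
next
  case (Suc k)
  define m where "m = n div 2"
  have m: "m \<le> n" "m \<le> 2 ^ k" "n - m \<le> 2 ^ k"
    using Suc.prems(1) by (auto simp: m_def)
  have "b - real k * \<delta> \<le> gromov_product w (f 0) (f m)"
    using Suc.prems m by (intro Suc.IH) auto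
  moreover have "b - real k * \<delta> \<le> gromov_product w ((\<lambda>i. f (m + i)) 0) ((\<lambda>i. f (m + i)) (n - m))"
    using Suc.prems(2,3) m by (intro Suc.IH) auto
  moreover have "min (gromov_product w (f 0) (f m)) (gromov_product w (f m) (f n)) - \<delta>
      \<le> gromov_product w (f 0) (f n)"
    using hyp by (simp add: four_point_hyperbolic_def)
  ultimately show ?case using m by (simp add: algebra_simps min_def split: if_splits)
qed

text \<open>
  Used with \<open>D\<close> the largest distance from a geodesic to \<open>Q\<close>: there is a detour through \<open>Q\<close> of at most
  \<open>A * (6 * D + 7)\<close> steps, and \<open>k\<close> halvings of it cost \<open>k * \<delta>\<close> in the Gromov product.
\<close>

lemma bounded_if_le_log:
  assumes "A \<ge> (1::real)"
  shows "\<exists>\<sigma>\<ge>0. \<forall>D\<ge>0. (\<forall>k::nat. A * (6 * D + 7) \<le> 2 ^ k \<longrightarrow> D \<le> b + real k * \<delta>) \<longrightarrow> D \<le> \<sigma>"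
proof -
  have "eventually (\<lambda>D. D > b + (log 2 (A * (6 * D + 7)) + 1) * \<bar>\<delta>\<bar>) at_top"
    using assms by real_asymp
  then obtain \<sigma> where \<sigma>: "\<And>D. D \<ge> \<sigma> \<Longrightarrow> D > b + (log 2 (A * (6 * D + 7)) + 1) * \<bar>\<delta>\<bar>"
    by (auto simp: eventually_at_top_linorder)
  show ?thesis
  proof (intro exI[of _ "max \<sigma> 0"] conjI allI impI)
    fix D :: real assume D: "0 \<le> D" "\<forall>k::nat. A * (6 * D + 7) \<le> 2 ^ k \<longrightarrow> D \<le> b + real k * \<delta>"
    have "1 * 1 \<le> A * (6 * D + 7)" using D assms by (intro mult_mono) auto
    then have A1: "1 \<le> A * (6 * D + 7)" by simp
    define k where "k = nat \<lceil>log 2 (A * (6 * D + 7))\<rceil>"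
    have lg: "0 \<le> log 2 (A * (6 * D + 7))" using A1 by simp
    then have k: "log 2 (A * (6 * D + 7)) \<le> real k" "real k \<le> log 2 (A * (6 * D + 7)) + 1"
      unfolding k_def by linarith+
    then have "A * (6 * D + 7) \<le> 2 powr real k" using A1 by (subst (asm) log_le_iff) auto
    then have "D \<le> b + real k * \<delta>" using D(2) by (simp add: powr_realpow)
    also have "real k * \<delta> \<le> real k * \<bar>\<delta>\<bar>" by (simp add: mult_left_mono)
    also have "\<dots> \<le> (log 2 (A * (6 * D + 7)) + 1) * \<bar>\<delta>\<bar>"
      using k by (simp add: mult_right_mono)
    finally show "D \<le> max \<sigma> 0" using \<sigma>[of D] by fastforce
  qed auto
qed

lemma gromov_product_ge:
  assumes "D \<le> dist u w" "D \<le> dist v w" "dist u v \<le> s"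
  shows "D - s / 2 \<le> gromov_product w u v"
  using assms by (simp add: gromov_product_def)

lemma infdist_attains_almost:
  assumes "Q \<noteq> {}" "infdist y Q < e"
  shows "\<exists>z\<in>Q. dist y z < e"
  using assms by (simp add: infdist_notempty cINF_less_iff)

text \<open>Let \<open>w\<close> be the point of the geodesic farthest from \<open>Q\<close>, at
  distance \<open>D\<close>. A chain in \<open>Q\<close> joins points near the two sides of
  \<open>w\<close> and stays \<open>D\<close> away from \<open>w\<close>, so the Gromov product of
  the two sides at \<open>w\<close> is at least \<open>D\<close> minus a term logarithmic in
  \<open>D\<close>. It is also zero, because \<open>w\<close> lies between them on a geodesic. Hence
  \<open>D\<close> is bounded, uniformly over all \<open>Q\<close> with the same constants.\<close>

lemma linearly_chained_imp_quasiconvex: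
  assumes hyp: "four_point_hyperbolic \<delta> TYPE('x::metric_space)" and "0 \<le> \<delta>"
    and "1 \<le> A" and "0 \<le> \<mu>"
  shows "\<exists>\<sigma>\<ge>0. \<forall>Q::'x set. linearly_chained \<mu> A Q \<longrightarrow> quasiconvex \<sigma> Q"
proof -
  obtain \<sigma> where \<sigma>: "0 \<le> \<sigma>"
    "\<And>D. 0 \<le> D \<Longrightarrow> (\<And>k::nat. A * (6 * D + 7) \<le> 2 ^ k \<Longrightarrow> D \<le> (\<mu> / 2 + 2 * \<delta>) + real k * \<delta>) \<Longrightarrow> D \<le> \<sigma>"
    using bounded_if_le_log[OF \<open>1 \<le> A\<close>, of "\<mu> / 2 + 2 * \<delta>" \<delta>] by blast
  have "\<exists>z\<in>Q. dist (c s) z \<le> \<sigma> + 1"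
    if Q: "linearly_chained \<mu> A Q" and pq: "p \<in> Q" "q \<in> Q" and c: "geodesic_segment c p q"
      and s: "s \<in> {0..dist p q}" for Q :: "'x set" and p q c s
  proof -
    define l where "l = dist p q"
    have iso: "dist (c a) (c b) = \<bar>a - b\<bar>" if "a \<in> {0..l}" "b \<in> {0..l}" for a b
      using geodesic_segment_dist[OF c] that by (simp add: l_def)
    have c0: "c 0 = p" and cl: "c l = q" using geodesic_segment_ends[OF c] by (auto simp: l_def)
    have "continuous_on {0..l} c" using continuous_on_geodesic_segment[OF c] by (simp add: l_def)
    then have "continuous_on {0..l} (\<lambda>x. infdist (c x) Q)" by (rule continuous_on_infdist)
    then obtain t where t: "t \<in> {0..l}" "\<And>x. x \<in> {0..l} \<Longrightarrow> infdist (c x) Q \<le> infdist (c t) Q"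
      using continuous_attains_sup[of "{0..l}" "\<lambda>x. infdist (c x) Q"] by (auto simp: l_def)
    define w where "w = c t"
    define D where "D = infdist w Q"
    have D0: "0 \<le> D" by (simp add: D_def infdist_nonneg)
    have Dle: "D \<le> dist z w" if "z \<in> Q" for z
      using infdist_le[OF that, of w] by (simp add: D_def dist_commute)
    have near: "\<exists>z\<in>Q. dist (c x) z \<le> D + 1" if "x \<in> {0..l}" for x
    proof -
      have "infdist (c x) Q < D + 1" using t(2)[OF that] by (simp add: D_def w_def)
      moreover have "Q \<noteq> {}" using pq by auto
      ultimately obtain z where "z \<in> Q" "dist (c x) z < D + 1" using infdist_attains_almost by blast
      then show ?thesis by (intro bexI[of _ z]) auto
    qed
    \<comment> \<open>At distance \<open>2 * (D + 1)\<close> from \<open>w\<close>, a point of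
      \<open>Q\<close> within \<open>D + 1\<close> of \<open>u\<close> still has Gromov product at
      least \<open>D\<close> with \<open>u\<close>. If the geodesic ends earlier, the endpoint lies
      in \<open>Q\<close> and is its own partner.\<close>
    define u where "u = c (max 0 (t - 2 * (D + 1)))"
    define v where "v = c (min l (t + 2 * (D + 1)))"
    have mem: "max 0 (t - 2 * (D + 1)) \<in> {0..l}" "min l (t + 2 * (D + 1)) \<in> {0..l}"
      using t(1) D0 by auto
    have duw: "dist u w = min t (2 * (D + 1))" and dvw: "dist v w = min (l - t) (2 * (D + 1))"
      and duv: "dist u v = dist u w + dist v w"
      unfolding u_def v_def w_def using mem t(1) D0 by (auto simp: iso)
    obtain u' where u': "u' \<in> Q" "D \<le> gromov_product w u u'" "dist u u' \<le> D + 1"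
    proof (cases "t \<le> 2 * (D + 1)")
      case True
      then have "u = p" by (simp add: u_def c0 max_def)
      then show ?thesis using that[of p] Dle[OF pq(1)] pq D0 by (simp add: gromov_product_def)
    next
      case False
      obtain z where z: "z \<in> Q" "dist u z \<le> D + 1" using near[OF mem(1)] u_def by auto
      have "D \<le> gromov_product w u z"
        using z Dle[OF z(1)] False duw by (simp add: gromov_product_def)
      then show ?thesis using that z by blast
    qed
    obtain v' where v': "v' \<in> Q" "D \<le> gromov_product w v' v" "dist v v' \<le> D + 1"
    proof (cases "l - t \<le> 2 * (D + 1)")
      case True
      then have "v = q" by (simp add: v_def cl min_def)
      then show ?thesis using that[of q] Dle[OF pq(2)] pq D0 by (simp add: gromov_product_def)
    next
      case False
      obtain z where z: "z \<in> Q" "dist v z \<le> D + 1" using near[OF mem(2)] v_def by auto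
      have "D \<le> gromov_product w z v"
        using z Dle[OF z(1)] False dvw by (simp add: gromov_product_def dist_commute)
      then show ?thesis using that z by blast
    qed
    have "dist u' v' \<le> dist u u' + dist u v + dist v v'"
      using dist_triangle[of u' v' u] dist_triangle[of u v' v] by (simp add: dist_commute)
    also have "\<dots> \<le> 6 * (D + 1)" using u'(3) v'(3) duw dvw duv by simp
    finally have u'v': "dist u' v' \<le> 6 * (D + 1)" .
    obtain n f where f: "f 0 = u'" "f n = v'" "\<And>i. i \<le> n \<Longrightarrow> f i \<in> Q"
      "\<And>i. i < n \<Longrightarrow> dist (f i) (f (Suc i)) \<le> \<mu>" "real n \<le> A * (dist u' v' + 1)"
      using Q u'(1) v'(1) unfolding linearly_chained_def by metis
    have "D \<le> \<sigma>"
    proof (rule \<sigma>(2))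
      fix k :: nat assume k: "A * (6 * D + 7) \<le> 2 ^ k"
      have "real n \<le> A * (6 * D + 7)"
        using u'v' \<open>1 \<le> A\<close> by (intro order_trans[OF f(5)] mult_left_mono) auto
      then have "real n \<le> real (2 ^ k)" unfolding of_nat_power of_nat_numeral using k by linarith
      then have n: "n \<le> 2 ^ k" by (simp only: of_nat_le_iff)
      have "D - \<mu> / 2 - real k * \<delta> \<le> gromov_product w (f 0) (f n)"
      proof (rule gromov_product_chain[OF hyp \<open>0 \<le> \<delta>\<close> n])
        fix i assume "i \<le> n"
        then show "D - \<mu> / 2 \<le> dist (f i) w" using Dle f(3) \<open>0 \<le> \<mu>\<close> by fastforce
      next
        fix i assume "i < n"
        then show "D - \<mu> / 2 \<le> gromov_product w (f i) (f (Suc i))"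
          using f(3,4) Dle by (intro gromov_product_ge) auto
      qed
      \<comment> \<open>Two further inequalities pass from the pair \<open>u'\<close>,
        \<open>v'\<close> to \<open>u\<close>, \<open>v\<close>; they account for
        \<open>2 * \<delta>\<close> in the bound.\<close>
      moreover have "min (gromov_product w u u') (gromov_product w u' v) - \<delta> \<le> gromov_product w u v"
        "min (gromov_product w u' v') (gromov_product w v' v) - \<delta> \<le> gromov_product w u' v"
        using hyp by (auto simp: four_point_hyperbolic_def)
      moreover have "gromov_product w u v = 0" using duv by (simp add: gromov_product_def)
      moreover have "0 \<le> real k * \<delta>" using \<open>0 \<le> \<delta>\<close> by simp
      ultimately show "D \<le> (\<mu> / 2 + 2 * \<delta>) + real k * \<delta>"
        using u'(2) v'(2) \<open>0 \<le> \<mu>\<close> \<open>0 \<le> \<delta>\<close> unfolding f(1,2) by linarith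
    qed (rule D0)
    moreover obtain z where "z \<in> Q" "dist (c s) z \<le> D + 1" using near[of s] s by (auto simp: l_def)
    ultimately show ?thesis by (intro bexI[of _ z]) auto
  qed
  then show ?thesis using \<sigma>(1) unfolding quasiconvex_def
    by (intro exI[of _ "\<sigma> + 1"]) auto
qed

section \<open>Quasi-geodesic sequences in hyperbolic spaces\<close>

lemma discrete_quasi_geodesic_linearly_chained:
  assumes f: "discrete_quasi_geodesic dist \<kappa> n f" and "1 \<le> \<kappa>"
  shows "linearly_chained (2 * \<kappa>) (\<kappa> ^ 2) (f ` {..n})"
proof -
  have len: "real j - real i \<le> \<kappa>\<^sup>2 * (dist (f i) (f j) + 1)" if "i \<le> j" "j \<le> n" for i j
  proof -
    have "(real j - real i) / \<kappa> - \<kappa> \<le> dist (f i) (f j)"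
      using f that unfolding discrete_quasi_geodesic_def
      by (metis abs_minus_commute abs_of_nonneg diff_ge_0_iff_ge le_trans of_nat_mono)
    then have "real j - real i \<le> \<kappa> * dist (f i) (f j) + \<kappa>\<^sup>2"
      using \<open>1 \<le> \<kappa>\<close> by (simp add: field_simps power2_eq_square)
    also have "\<kappa> * dist (f i) (f j) \<le> \<kappa>\<^sup>2 * dist (f i) (f j)"
      using \<open>1 \<le> \<kappa>\<close> by (intro mult_right_mono) (auto simp: power2_eq_square)
    finally show ?thesis by (simp add: algebra_simps)
  qed
  have step: "dist (f i) (f j) \<le> 2 * \<kappa>" if "i = Suc j \<or> j = Suc i" "i \<le> n" "j \<le> n" for i j
  proof -
    have "dist (f i) (f j) \<le> \<kappa> * \<bar>real i - real j\<bar> + \<kappa>"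
      using f that unfolding discrete_quasi_geodesic_def by blast
    moreover have "\<bar>real i - real j\<bar> = 1" using that by auto
    ultimately show ?thesis by simp
  qed
  have "\<exists>m g. g 0 = f i \<and> g m = f j \<and> (\<forall>k\<le>m. g k \<in> f ` {..n}) \<and>
     (\<forall>k<m. dist (g k) (g (Suc k)) \<le> 2 * \<kappa>) \<and> real m \<le> \<kappa>\<^sup>2 * (dist (f i) (f j) + 1)"
    if "i \<le> n" "j \<le> n" for i j
  proof (cases "i \<le> j")
    case True
    then show ?thesis using that len[of i j]
      by (intro exI[of _ "j - i"] exI[of _ "\<lambda>k. f (i + k)"]) (auto intro!: step)
  next
    case False
    then show ?thesis using that len[of j i]
      by (intro exI[of _ "i - j"] exI[of _ "\<lambda>k. f (i - k)"]) (auto intro!: step simp: dist_commute)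
  qed
  then show ?thesis unfolding linearly_chained_def by auto
qed

text \<open>Quasiconvexity puts the geodesic near both sequences; the converse, that
  \<open>f i\<close> is near the geodesic, comes from connectedness. Some point of the geodesic is
  near both an \<open>f j\<close> with \<open>j \<le> i\<close> and an \<open>f j'\<close> with
  \<open>i \<le> j'\<close>. Then \<open>f j\<close> and \<open>f j'\<close> are close, so
  \<open>j' - j\<close> is bounded and \<open>f i\<close> is close to \<open>f j\<close>.\<close>

lemma morse:
  assumes geo: "geodesic_space TYPE('x::metric_space)"
    and hyp: "four_point_hyperbolic \<delta> TYPE('x)" "0 \<le> \<delta>" and "1 \<le> \<kappa>"
  shows "\<exists>L\<ge>0. \<forall>n m (f::nat \<Rightarrow> 'x) g. discrete_quasi_geodesic dist \<kappa> n f \<longrightarrow>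
    discrete_quasi_geodesic dist \<kappa> m g \<longrightarrow> f 0 = g 0 \<longrightarrow> f n = g m \<longrightarrow>
    (\<forall>i\<le>n. \<exists>j\<le>m. dist (f i) (g j) \<le> L)"
proof -
  have "1 \<le> \<kappa>\<^sup>2" using \<open>1 \<le> \<kappa>\<close> by simp
  then obtain \<sigma> where \<sigma>: "0 \<le> \<sigma>" "\<And>Q::'x set. linearly_chained (2 * \<kappa>) (\<kappa>\<^sup>2) Q \<Longrightarrow> quasiconvex \<sigma> Q"
    using linearly_chained_imp_quasiconvex[OF hyp, of "\<kappa>\<^sup>2" "2 * \<kappa>"] \<open>1 \<le> \<kappa>\<close> by auto
  define L where "L = \<kappa> * (\<kappa> * (2 * \<sigma> + \<kappa>)) + \<kappa> + 2 * \<sigma>"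
  have "\<exists>j\<le>m. dist (f i) (g j) \<le> L"
    if f: "discrete_quasi_geodesic dist \<kappa> n f" and g: "discrete_quasi_geodesic dist \<kappa> m g"
      and eq: "f 0 = g 0" "f n = g m" and i: "i \<le> n" for n m i and f g :: "nat \<Rightarrow> 'x"
  proof -
    obtain c where c: "geodesic_segment c (f 0) (f n)" using geodesic_spaceD[OF geo] by blast
    define l where "l = dist (f 0) (f n)"
    have iso: "dist (c a) (c b) = \<bar>a - b\<bar>" if "a \<in> {0..l}" "b \<in> {0..l}" for a b
      using geodesic_segment_dist[OF c] that by (simp add: l_def)
    have c0: "c 0 = f 0" and cl: "c l = f n"
      using geodesic_segment_ends[OF c] by (auto simp: l_def)
    have cont: "continuous_on {0..l} c"
      using continuous_on_geodesic_segment[OF c] by (simp add: l_def)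
    have nf: "\<exists>j\<le>n. dist (c t) (f j) \<le> \<sigma>" if "t \<in> {0..l}" for t
      using \<sigma>(2)[OF discrete_quasi_geodesic_linearly_chained[OF f \<open>1 \<le> \<kappa>\<close>]] c that
      unfolding quasiconvex_def l_def by fastforce
    have ng: "\<exists>j\<le>m. dist (c t) (g j) \<le> \<sigma>" if "t \<in> {0..l}" for t
      using \<sigma>(2)[OF discrete_quasi_geodesic_linearly_chained[OF g \<open>1 \<le> \<kappa>\<close>]] c that eq
      unfolding quasiconvex_def l_def by fastforce
    define B where "B = (\<lambda>j. {t\<in>{0..l}. dist (c t) (f j) \<le> \<sigma>})"
    have clB: "closed (B j)" for j
      unfolding B_def by (intro continuous_on_closed_Collect_le continuous_intros cont)
    \<comment> \<open>The parameters near the first part of \<open>f\<close> and those near the last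
      part form two closed sets covering the interval; the first contains \<open>0\<close> and the
      second contains \<open>l\<close>.\<close>
    have "(\<Union>j\<in>{..i}. B j) \<inter> (\<Union>j\<in>{i..n}. B j) \<inter> {0..l} \<noteq> {}"
    proof (rule ccontr)
      assume "\<not> ?thesis"
      moreover have "closed (\<Union>j\<in>{..i}. B j)" "closed (\<Union>j\<in>{i..n}. B j)"
        using clB by auto
      moreover have "{0..l} \<subseteq> (\<Union>j\<in>{..i}. B j) \<union> (\<Union>j\<in>{i..n}. B j)"
      proof
        fix t assume t: "t \<in> {0..l}"
        then obtain j where "j \<le> n" "t \<in> B j" using nf by (auto simp: B_def)
        then show "t \<in> (\<Union>j\<in>{..i}. B j) \<union> (\<Union>j\<in>{i..n}. B j)" by (cases "j \<le> i") auto
      qed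
      moreover have "0 \<in> (\<Union>j\<in>{..i}. B j) \<inter> {0..l}" "l \<in> (\<Union>j\<in>{i..n}. B j) \<inter> {0..l}"
        using i \<sigma>(1) c0 cl by (fastforce simp: B_def l_def)+
      ultimately show False using connected_closedD[of "{0..l}" "\<Union>j\<in>{..i}. B j" "\<Union>j\<in>{i..n}. B j"]
        by (metis connected_Icc emptyE inf_commute)
    qed
    then obtain t where "t \<in> {0..l}" "t \<in> (\<Union>j\<in>{..i}. B j)" "t \<in> (\<Union>j\<in>{i..n}. B j)" by blast
    then obtain j j' where t: "t \<in> {0..l}" "dist (c t) (f j) \<le> \<sigma>" "dist (c t) (f j') \<le> \<sigma>"
      and j: "j \<le> i" "i \<le> j'" "j' \<le> n" unfolding B_def by auto
    obtain k where k: "k \<le> m" "dist (c t) (g k) \<le> \<sigma>" using ng[OF t(1)] by blast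
    have "(real j' - real j) / \<kappa> - \<kappa> \<le> dist (f j') (f j)"
      using f j unfolding discrete_quasi_geodesic_def by (metis abs_of_nonneg diff_ge_0_iff_ge le_trans of_nat_mono)
    also have "\<dots> \<le> 2 * \<sigma>" using t dist_triangle[of "f j'" "f j" "c t"] by (simp add: dist_commute)
    finally have jj: "real j' - real j \<le> \<kappa> * (2 * \<sigma> + \<kappa>)" using \<open>1 \<le> \<kappa>\<close> by (simp add: field_simps)
    have "dist (f i) (f j) \<le> \<kappa> * \<bar>real i - real j\<bar> + \<kappa>"
      using discrete_quasi_geodesicD(2)[OF f, of i j] j by simp
    also have "\<dots> \<le> \<kappa> * (\<kappa> * (2 * \<sigma> + \<kappa>)) + \<kappa>"
      using jj j \<open>1 \<le> \<kappa>\<close> by (intro add_mono mult_left_mono) auto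
    finally have "dist (f i) (g k) \<le> L"
      using t k dist_triangle[of "f i" "g k" "f j"] dist_triangle[of "f j" "g k" "c t"]
      by (simp add: L_def dist_commute)
    then show ?thesis using k by blast
  qed
  moreover have "0 \<le> L" using \<sigma>(1) \<open>1 \<le> \<kappa>\<close> by (simp add: L_def)
  ultimately show ?thesis by blast
qed

section \<open>Projection to a quasiconvex set\<close>

text \<open>A large product would mean that the geodesic from \<open>p\<close> to \<open>q\<close>
  first runs towards \<open>y\<close>. Its point at distance \<open>t\<close> from \<open>p\<close>
  is closer to \<open>y\<close> than \<open>p\<close> by about \<open>t\<close>, and by
  quasiconvexity a point of \<open>Q\<close> is nearby, so \<open>p\<close> would not be nearly
  closest unless \<open>t\<close> is bounded.\<close>

lemma near_projection_gromov_product: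
  assumes geo: "geodesic_space TYPE('x::metric_space)"
    and hyp: "four_point_hyperbolic \<delta> TYPE('x)" "0 \<le> \<delta>"
    and Q: "quasiconvex \<sigma> Q" "p \<in> Q" "q \<in> Q" and y: "dist (y::'x) p \<le> infdist y Q + 1"
  shows "gromov_product p y q \<le> 2 * \<delta> + \<sigma> + 1"
proof -
  obtain c where c: "geodesic_segment c p q" using geodesic_spaceD[OF geo] by blast
  define t where "t = gromov_product p y q"
  have t: "t \<in> {0..dist p q}"
    using dist_triangle[of y q p] dist_triangle[of y p q]
    by (auto simp: t_def gromov_product_def dist_commute)
  then obtain z where z: "z \<in> Q" "dist (c t) z \<le> \<sigma>" using Q c unfolding quasiconvex_def by blast
  have "dist p (c t) = t" "dist (c t) q = dist p q - t"
    using geodesic_segment_dist[OF c, of 0 t] geodesic_segment_dist[OF c, of t "dist p q"] t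
    by (auto simp: geodesic_segment_ends[OF c])
  then have dt: "dist (c t) p = t" "dist q (c t) = dist p q - t"
    by (simp_all add: dist_commute)
  have "min (gromov_product p y q) (gromov_product p q (c t)) - \<delta> \<le> gromov_product p y (c t)"
    using hyp by (auto simp: four_point_hyperbolic_def)
  then have "t - \<delta> \<le> gromov_product p y (c t)"
    using dt by (simp add: t_def[symmetric]) (simp add: gromov_product_def dist_commute)
  then have "dist y (c t) \<le> dist y p - t + 2 * \<delta>" using dt by (simp add: gromov_product_def)
  then have "dist y z \<le> dist y p - t + 2 * \<delta> + \<sigma>" using z dist_triangle[of y z "c t"] by simp
  then show ?thesis using y infdist_le[OF z(1), of y] by (simp add: t_def)
qed

text \<open>If \<open>p\<close> and \<open>p'\<close> are far apart, the broken path through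
  \<open>y\<close>, \<open>p\<close>, \<open>p'\<close>, \<open>y'\<close> is nearly geodesic. One
  estimate covers both later uses: a bound independent of \<open>y'\<close> when
  \<open>dist y y'\<close> is at most \<open>dist y p\<close>, and a coarse Lipschitz bound in
  general.\<close>

lemma near_projection_contracting:
  assumes geo: "geodesic_space TYPE('x::metric_space)"
    and hyp: "four_point_hyperbolic \<delta> TYPE('x)" "0 \<le> \<delta>"
    and Q: "quasiconvex \<sigma> Q" "0 \<le> \<sigma>"
    and p: "p \<in> Q" "dist (y::'x) p \<le> infdist y Q + 1"
    and p': "p' \<in> Q" "dist y' p' \<le> infdist y' Q + 1"
  shows "dist p p' \<le> max 0 (dist y y' - dist y p) + 10 * \<delta> + 4 * \<sigma> + 4"
proof -
  have "gromov_product p y p' \<le> 2 * \<delta> + \<sigma> + 1" "gromov_product p' y' p \<le> 2 * \<delta> + \<sigma> + 1"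
    using near_projection_gromov_product[OF geo hyp Q(1)] p p' by auto
  moreover have "min (gromov_product y p p') (gromov_product y p' y') - \<delta> \<le> gromov_product y p y'"
    using hyp by (auto simp: four_point_hyperbolic_def)
  ultimately have "dist y p + dist p p' \<le> dist y p' + (4 * \<delta> + 2 * \<sigma> + 2)"
    "dist y' p' + dist p p' \<le> dist y' p + (4 * \<delta> + 2 * \<sigma> + 2)"
    \<comment> \<open>This is the four-point inequality in its form with sums of opposite distances.
      The second alternative already bounds \<open>dist p p'\<close> by half of the final
      constant.\<close>
    "dist y p' + dist y' p \<le> dist p p' + dist y y' + 2 * \<delta> \<or>
      dist y p' + dist y' p \<le> dist y p + dist y' p' + 2 * \<delta>"
    by (auto simp: gromov_product_def min_def dist_commute field_simps split: if_splits)
  then show ?thesis using \<open>0 \<le> \<delta>\<close> \<open>0 \<le> \<sigma>\<close> zero_le_dist[of y' p'] zero_le_dist[of p p']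
    by linarith
qed

lemma dist_chain:
  fixes f :: "nat \<Rightarrow> 'x::metric_space"
  assumes "\<And>i. a \<le> i \<Longrightarrow> i < a + k \<Longrightarrow> dist (f i) (f (Suc i)) \<le> \<mu>"
  shows "dist (f a) (f (a + k)) \<le> real k * \<mu>"
  using assms
proof (induction k)
  case (Suc k)
  then have "dist (f a) (f (a + k)) \<le> real k * \<mu>" "dist (f (a + k)) (f (Suc (a + k))) \<le> \<mu>" by auto
  then show ?case using dist_triangle[of "f a" "f (a + Suc k)" "f (a + k)"]
    by (simp add: algebra_simps)
qed simp

text \<open>Any \<open>m\<close> consecutive steps stay within the distance to \<open>Q\<close>, so
  they move the projection by at most \<open>D\<close>. The rate is thus \<open>D / m\<close> per
  step, and the summand \<open>1\<close> pays for an incomplete group of steps.\<close>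

lemma projection_of_distant_chain:
  fixes f :: "nat \<Rightarrow> 'x::metric_space" and p :: "'x \<Rightarrow> 'x"
  assumes contr: "\<And>y y'. dist y y' \<le> infdist y Q \<Longrightarrow> dist (p y) (p y') \<le> D"
    and "0 \<le> D" and "0 \<le> \<mu>" and "1 \<le> m"
    and "\<And>i. a \<le> i \<Longrightarrow> i < a + k \<Longrightarrow> dist (f i) (f (Suc i)) \<le> \<mu>"
    and "\<And>i. a \<le> i \<Longrightarrow> i \<le> a + k \<Longrightarrow> real m * \<mu> \<le> infdist (f i) Q"
  shows "dist (p (f a)) (p (f (a + k))) \<le> D * (real k / real m + 1)"
  using assms(5-)
proof (induction k arbitrary: a rule: less_induct)
  case (less k)
  have block: "dist (p (f a)) (p (f (a + j))) \<le> D" if "j \<le> m" "j \<le> k" for j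
  proof (rule contr)
    have "dist (f a) (f (a + j)) \<le> real j * \<mu>" using less.prems(1) that by (intro dist_chain) auto
    also have "\<dots> \<le> real m * \<mu>" using that \<open>0 \<le> \<mu>\<close> by (intro mult_right_mono) auto
    also have "\<dots> \<le> infdist (f a) Q" using less.prems(2) by simp
    finally show "dist (f a) (f (a + j)) \<le> infdist (f a) Q" .
  qed
  show ?case
  proof (cases "k \<le> m")
    case True
    have "D * 1 \<le> D * (real k / real m + 1)" using \<open>0 \<le> D\<close> by (intro mult_left_mono) auto
    then show ?thesis using block[of k] True by simp
  next
    case False
    then have k: "a + k = (a + m) + (k - m)" "real (k - m) = real k - real m" by auto
    have "dist (p (f (a + m))) (p (f (a + k))) \<le> D * (real (k - m) / real m + 1)"
      unfolding k(1) using False \<open>1 \<le> m\<close> by (intro less.IH less.prems) auto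
    also have "real (k - m) / real m + 1 = real k / real m"
      using \<open>1 \<le> m\<close> k(2) by (simp add: field_simps)
    finally show ?thesis
      using block[of m] False dist_triangle[of "p (f a)" "p (f (a + k))" "p (f (a + m))"]
      by (simp add: algebra_simps)
  qed
qed

section \<open>Word metrics\<close>

context group
begin

lemma inv_mult_cancel:
  assumes "k \<in> carrier G" "h \<in> carrier G"
  shows "inv k \<otimes> (k \<otimes> h) = h" "k \<otimes> (inv k \<otimes> h) = h"
  using assms by (simp_all add: m_assoc[symmetric])

lemma foldr_mult_closed:
  assumes "set ws \<subseteq> carrier G"
  shows "foldr (\<otimes>) ws \<one> \<in> carrier G"
  using assms by (induction ws) auto

lemma foldr_mult_append:
  assumes "set ws \<subseteq> carrier G" "set vs \<subseteq> carrier G"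
  shows "foldr (\<otimes>) (ws @ vs) \<one> = foldr (\<otimes>) ws \<one> \<otimes> foldr (\<otimes>) vs \<one>"
  using assms by (induction ws) (auto simp: m_assoc foldr_mult_closed)

lemma foldr_mult_inv:
  assumes "set ws \<subseteq> carrier G"
  shows "foldr (\<otimes>) (rev (map (m_inv G) ws)) \<one> = inv (foldr (\<otimes>) ws \<one>)"
  using assms
proof (induction ws)
  case (Cons a ws)
  then have "set (rev (map (m_inv G) ws)) \<subseteq> carrier G" by auto
  then show ?case using Cons foldr_mult_append[of "rev (map (m_inv G) ws)" "[inv a]"]
    by (simp add: inv_mult_group foldr_mult_closed)
qed simp

lemma letters_subset_carrier:
  assumes "T \<subseteq> carrier G"
  shows "T \<union> m_inv G ` T \<subseteq> carrier G"
  using assms by auto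

lemma foldr_mult_generate:
  assumes "set ws \<subseteq> T \<union> m_inv G ` T"
  shows "foldr (\<otimes>) ws \<one> \<in> generate G T"
  using assms by (induction ws) (auto intro: generate.intros)

lemma word_length_le:
  assumes "set ws \<subseteq> T \<union> m_inv G ` T" "foldr (\<otimes>) ws \<one> = g"
  shows "word_length G T g \<le> length ws"
  using assms unfolding word_length_def by (intro Least_le) auto

lemma word_exists:
  assumes T: "T \<subseteq> carrier G" and "g \<in> generate G T"
  shows "\<exists>ws. set ws \<subseteq> T \<union> m_inv G ` T \<and> foldr (\<otimes>) ws \<one> = g"
  using assms(2)
proof (induction rule: generate.induct)
  case one
  then show ?case by (intro exI[of _ "[]"]) auto
next
  case (incl h)
  then show ?case using T by (intro exI[of _ "[h]"]) auto
next
  case (inv h)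
  then show ?case using T by (intro exI[of _ "[inv h]"]) auto
next
  case (eng h1 h2)
  then obtain ws vs where "set ws \<subseteq> T \<union> m_inv G ` T" "foldr (\<otimes>) ws \<one> = h1"
    "set vs \<subseteq> T \<union> m_inv G ` T" "foldr (\<otimes>) vs \<one> = h2" by blast
  moreover from this have "set ws \<subseteq> carrier G" "set vs \<subseteq> carrier G"
    using letters_subset_carrier[OF T] by auto
  ultimately have "set (ws @ vs) \<subseteq> T \<union> m_inv G ` T" "foldr (\<otimes>) (ws @ vs) \<one> = h1 \<otimes> h2"
    using foldr_mult_append[of ws vs] by auto
  then show ?case by blast
qed

lemma geodesic_word:
  assumes "T \<subseteq> carrier G" "g \<in> generate G T"
  obtains ws where "set ws \<subseteq> T \<union> m_inv G ` T" "foldr (\<otimes>) ws \<one> = g" "length ws = word_length G T g"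
proof -
  obtain vs where "set vs \<subseteq> T \<union> m_inv G ` T" "foldr (\<otimes>) vs \<one> = g"
    using word_exists[OF assms] by blast
  then have "\<exists>ws. length ws = word_length G T g \<and> set ws \<subseteq> T \<union> m_inv G ` T \<and> foldr (\<otimes>) ws \<one> = g"
    unfolding word_length_def by (intro LeastI_ex[of "\<lambda>n. \<exists>ws. length ws = n \<and>
      set ws \<subseteq> T \<union> m_inv G ` T \<and> foldr (\<otimes>) ws \<one> = g"]) blast
  then obtain ws where "length ws = word_length G T g" "set ws \<subseteq> T \<union> m_inv G ` T" "foldr (\<otimes>) ws \<one> = g"
    by blast
  then show ?thesis by (intro that)
qed

lemma word_length_one: "word_length G T \<one> = 0"
  using word_length_le[of "[]" T \<one>] by simp

lemma word_length_mult:
  assumes T: "T \<subseteq> carrier G" and "g \<in> generate G T" "h \<in> generate G T"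
  shows "word_length G T (g \<otimes> h) \<le> word_length G T g + word_length G T h"
proof -
  obtain ws where ws: "set ws \<subseteq> T \<union> m_inv G ` T" "foldr (\<otimes>) ws \<one> = g" "length ws = word_length G T g"
    using geodesic_word assms by blast
  obtain vs where vs: "set vs \<subseteq> T \<union> m_inv G ` T" "foldr (\<otimes>) vs \<one> = h" "length vs = word_length G T h"
    using geodesic_word assms by blast
  have "set ws \<subseteq> carrier G" "set vs \<subseteq> carrier G" using letters_subset_carrier[OF T] ws vs by auto
  then have "word_length G T (g \<otimes> h) \<le> length (ws @ vs)"
    using ws vs foldr_mult_append[of ws vs] by (intro word_length_le) auto
  then show ?thesis using ws vs by simp
qed

lemma word_length_inv:
  assumes T: "T \<subseteq> carrier G" and "g \<in> generate G T"
  shows "word_length G T (inv g) = word_length G T g"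
proof -
  have le: "word_length G T (inv g) \<le> word_length G T g" if g: "g \<in> generate G T" for g
  proof -
    obtain ws where ws: "set ws \<subseteq> T \<union> m_inv G ` T" "foldr (\<otimes>) ws \<one> = g" "length ws = word_length G T g"
      using geodesic_word T g by blast
    have "set ws \<subseteq> carrier G" using letters_subset_carrier[OF T] ws by auto
    moreover have "inv s \<in> T \<union> m_inv G ` T" if "s \<in> T \<union> m_inv G ` T" for s
      using that T by (auto simp: subset_iff)
    then have "m_inv G ` set ws \<subseteq> T \<union> m_inv G ` T" using ws(1) by blast
    then have "set (rev (map (m_inv G) ws)) \<subseteq> T \<union> m_inv G ` T" by simp
    ultimately have "word_length G T (inv g) \<le> length (rev (map (m_inv G) ws))"
      using ws(2) foldr_mult_inv[of ws] by (intro word_length_le) simp_all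
    then show ?thesis using ws by simp
  qed
  have "g \<in> carrier G" "inv g \<in> generate G T"
    using generate_in_carrier[OF assms] generate_m_inv_closed[OF assms] by auto
  then show ?thesis using le[OF assms(2)] le[of "inv g"] by simp
qed

lemma finite_word_ball:
  assumes "finite T" "T \<subseteq> carrier G"
  shows "finite {g \<in> generate G T. word_length G T g \<le> n}"
proof (rule finite_subset)
  show "{g \<in> generate G T. word_length G T g \<le> n}
    \<subseteq> (\<lambda>ws. foldr (\<otimes>) ws \<one>) ` {ws. set ws \<subseteq> T \<union> m_inv G ` T \<and> length ws \<le> n}"
  proof
    fix g assume g: "g \<in> {g \<in> generate G T. word_length G T g \<le> n}"
    then obtain ws where "set ws \<subseteq> T \<union> m_inv G ` T" "foldr (\<otimes>) ws \<one> = g"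
      "length ws = word_length G T g"
      using geodesic_word[OF assms(2)] by blast
    moreover from this have "length ws \<le> n" using g by simp
    ultimately show "g \<in> (\<lambda>ws. foldr (\<otimes>) ws \<one>) ` {ws. set ws \<subseteq> T \<union> m_inv G ` T \<and> length ws \<le> n}"
      by blast
  qed
  show "finite ((\<lambda>ws. foldr (\<otimes>) ws \<one>) ` {ws. set ws \<subseteq> T \<union> m_inv G ` T \<and> length ws \<le> n})"
    using assms(1) by (intro finite_imageI finite_lists_length_le finite_UnI)
qed

text \<open>Applied with \<open>N\<close> the word length for another generating set, and with
  \<open>N\<close> the displacement of a base point under an isometric action.\<close>

lemma subadditive_le_word_length:
  fixes N :: "'a \<Rightarrow> real"
  assumes T: "T \<subseteq> carrier G" and g: "g \<in> generate G T" and "N \<one> \<le> 0"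
    and sub: "\<And>g h. g \<in> generate G T \<Longrightarrow> h \<in> generate G T \<Longrightarrow> N (g \<otimes> h) \<le> N g + N h"
    and K: "\<And>s. s \<in> T \<union> m_inv G ` T \<Longrightarrow> N s \<le> K"
  shows "N g \<le> K * word_length G T g"
proof -
  have "N (foldr (\<otimes>) ws \<one>) \<le> K * length ws" if "set ws \<subseteq> T \<union> m_inv G ` T" for ws
    using that
  proof (induction ws)
    case Nil
    then show ?case using \<open>N \<one> \<le> 0\<close> by simp
  next
    case (Cons s ws)
    then have "N (foldr (\<otimes>) (s # ws) \<one>) \<le> N s + N (foldr (\<otimes>) ws \<one>)"
      using foldr_mult_generate[of ws T] sub[of s] by (auto intro: generate.incl generate.inv)
    then show ?case using Cons K[of s] by (simp add: algebra_simps)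
  qed
  then show ?thesis using geodesic_word[OF T g] by metis
qed

lemma bounded_on_letters:
  fixes N :: "'a \<Rightarrow> real"
  assumes "finite T"
  obtains K where "1 \<le> K" "\<And>s. s \<in> T \<union> m_inv G ` T \<Longrightarrow> N s \<le> K"
proof -
  define K where "K = Max (insert 1 (N ` (T \<union> m_inv G ` T)))"
  have fin: "finite (insert 1 (N ` (T \<union> m_inv G ` T)))" using assms by auto
  show ?thesis
  proof (rule that)
    show "1 \<le> K" unfolding K_def by (rule Max_ge[OF fin]) simp
    show "N s \<le> K" if "s \<in> T \<union> m_inv G ` T" for s
      unfolding K_def by (rule Max_ge[OF fin]) (use that in auto)
  qed
qed

lemma word_dist_self: "g \<in> carrier G \<Longrightarrow> word_dist G T g g = 0"
  by (simp add: word_dist_def word_length_one)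

lemma generate_ratio:
  assumes "T \<subseteq> carrier G" "g \<in> generate G T" "h \<in> generate G T"
  shows "inv g \<otimes> h \<in> generate G T"
  using assms by (intro generate.eng generate_m_inv_closed)

lemma word_dist_commute:
  assumes T: "T \<subseteq> carrier G" and gh: "g \<in> generate G T" "h \<in> generate G T"
  shows "word_dist G T g h = word_dist G T h g"
proof -
  have "g \<in> carrier G" "h \<in> carrier G" using assms generate_in_carrier by auto
  then have "inv h \<otimes> g = inv (inv g \<otimes> h)" by (simp add: inv_mult_group)
  then show ?thesis using word_length_inv[OF T generate_ratio[OF assms]] by (simp add: word_dist_def)
qed

lemma word_dist_triangle:
  assumes T: "T \<subseteq> carrier G" and ghk: "g \<in> generate G T" "h \<in> generate G T" "k \<in> generate G T"
  shows "word_dist G T g k \<le> word_dist G T g h + word_dist G T h k"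
proof -
  have "g \<in> carrier G" "h \<in> carrier G" "k \<in> carrier G" using assms generate_in_carrier by auto
  then have "inv g \<otimes> k = (inv g \<otimes> h) \<otimes> (inv h \<otimes> k)"
    by (simp add: m_assoc inv_mult_cancel)
  then show ?thesis
    using word_length_mult[OF T generate_ratio[OF T ghk(1,2)] generate_ratio[OF T ghk(2,3)]]
    by (simp add: word_dist_def)
qed

lemma word_dist_comparison:
  assumes T: "finite T" "T \<subseteq> carrier G" and U: "U \<subseteq> carrier G" "generate G T \<subseteq> generate G U"
  obtains K where "1 \<le> K"
    "\<And>g h. g \<in> generate G T \<Longrightarrow> h \<in> generate G T \<Longrightarrow> word_dist G U g h \<le> K * word_dist G T g h"
proof -
  obtain K where K: "1 \<le> K" "\<And>s. s \<in> T \<union> m_inv G ` T \<Longrightarrow> real (word_length G U s) \<le> K"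
    by (rule bounded_on_letters[OF T(1), where N = "\<lambda>s. real (word_length G U s)"]) (rule that)
  have "word_dist G U g h \<le> K * word_dist G T g h" if "g \<in> generate G T" "h \<in> generate G T" for g h
    unfolding word_dist_def
  proof (rule subadditive_le_word_length[OF T(2) generate_ratio[OF T(2) that]])
    show "real (word_length G U (a \<otimes> b)) \<le> real (word_length G U a) + real (word_length G U b)"
      if "a \<in> generate G T" "b \<in> generate G T" for a b
    proof -
      have "word_length G U (a \<otimes> b) \<le> word_length G U a + word_length G U b"
        using that U(2) by (intro word_length_mult[OF U(1)]) auto
      then show ?thesis by linarith
    qed
  qed (use K word_length_one in auto)
  then show ?thesis by (rule that[OF K(1)])
qed

text \<open>The prefixes of a geodesic word. All of them lie in the subgroup generated by
  \<open>T\<close>, so the path gives chains inside an orbit of \<open>H\<close> as well as edge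
  paths in a Cayley graph.\<close>

lemma geodesic_word_path:
  assumes T: "T \<subseteq> carrier G" and gh: "g \<in> generate G T" "h \<in> generate G T"
  obtains f where "f 0 = g" "f (word_length G T (inv g \<otimes> h)) = h" "\<And>i. f i \<in> generate G T"
    "\<And>i. i < word_length G T (inv g \<otimes> h) \<Longrightarrow> \<exists>s\<in>T \<union> m_inv G ` T. f (Suc i) = f i \<otimes> s"
proof -
  obtain ws where ws: "set ws \<subseteq> T \<union> m_inv G ` T" "foldr (\<otimes>) ws \<one> = inv g \<otimes> h"
    "length ws = word_length G T (inv g \<otimes> h)"
    using geodesic_word[OF T generate_ratio[OF assms]] by blast
  have car: "set ws \<subseteq> carrier G" "g \<in> carrier G" "h \<in> carrier G"
    using letters_subset_carrier[OF T] ws gh generate_in_carrier[OF T] by auto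
  define f where "f i = g \<otimes> foldr (\<otimes>) (take i ws) \<one>" for i
  have "set (take i ws) \<subseteq> T \<union> m_inv G ` T" for i using ws(1) set_take_subset by fastforce
  then have "f i \<in> generate G T" for i
    unfolding f_def using gh foldr_mult_generate by (intro generate.eng) auto
  moreover have "f 0 = g" using car by (simp add: f_def)
  moreover have "f (word_length G T (inv g \<otimes> h)) = h"
    using ws(2) car unfolding f_def ws(3)[symmetric] by (simp add: inv_mult_cancel)
  moreover have "\<exists>s\<in>T \<union> m_inv G ` T. f (Suc i) = f i \<otimes> s" if "i < word_length G T (inv g \<otimes> h)" for i
  proof (intro bexI[of _ "ws ! i"])
    have i: "i < length ws" using that ws by simp
    then show mem: "ws ! i \<in> T \<union> m_inv G ` T" using ws(1) nth_mem by blast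
    have tc: "set (take i ws) \<subseteq> carrier G" "ws ! i \<in> carrier G"
      using car(1) i set_take_subset[of i ws] nth_mem[of i ws] by auto
    then show "f (Suc i) = f i \<otimes> ws ! i"
      using car foldr_mult_append[of "take i ws" "[ws ! i]"] unfolding f_def take_Suc_conv_app_nth[OF i]
      by (simp add: m_assoc foldr_mult_closed)
  qed
  ultimately show ?thesis using that by blast
qed

end

section \<open>Orbits of the subgroup\<close>

text \<open>One constant \<open>A\<close> and one base point \<open>x\<close> for everything. The
  word metric of \<open>H\<close> itself has disappeared: what remains of it is a coarse inverse of
  the orbit map on \<open>H\<close>, stated in the metric of \<open>G\<close>, and the chains in the
  orbit.\<close>

locale quasi_isometric_orbit = group G for G (structure) +
  fixes \<phi> :: "'a \<Rightarrow> 'x::metric_space \<Rightarrow> 'x" and H S :: "'a set" and x :: 'x and A \<delta> :: real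
  assumes subgroup_H: "subgroup H G"
    and finite_S: "finite S" and S_carrier: "S \<subseteq> carrier G" and generate_S: "generate G S = carrier G"
    and act_mult: "\<And>g h y. g \<in> carrier G \<Longrightarrow> h \<in> carrier G \<Longrightarrow> \<phi> (g \<otimes> h) y = \<phi> g (\<phi> h y)"
    and act_one: "\<And>y. \<phi> \<one> y = y"
    and act_isometry: "\<And>g y z. g \<in> carrier G \<Longrightarrow> dist (\<phi> g y) (\<phi> g z) = dist y z"
    and geodesic: "geodesic_space TYPE('x)"
    and hyperbolic: "four_point_hyperbolic \<delta> TYPE('x)" "0 \<le> \<delta>"
    and acylindrical: "acylindrical_along_set G \<phi> ((\<lambda>h. \<phi> h x) ` H)"
    and A_ge_1: "1 \<le> A"
    and orbit_lipschitz: "\<And>g h. g \<in> carrier G \<Longrightarrow> h \<in> carrier G \<Longrightarrow>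
      dist (\<phi> g x) (\<phi> h x) \<le> A * word_dist G S g h"
    and orbit_coarse_inverse: "\<And>g h. g \<in> H \<Longrightarrow> h \<in> H \<Longrightarrow>
      word_dist G S g h \<le> A * (dist (\<phi> g x) (\<phi> h x) + 1)"
    and orbit_chained: "linearly_chained A A ((\<lambda>h. \<phi> h x) ` H)"
begin

abbreviation d :: "'a \<Rightarrow> 'a \<Rightarrow> real" where "d \<equiv> word_dist G S"

definition Q :: "'x set" where "Q = (\<lambda>h. \<phi> h x) ` H"

definition projection :: "'x \<Rightarrow> 'x" where
  "projection y = (SOME p. p \<in> Q \<and> dist y p \<le> infdist y Q + 1)"

abbreviation orbit_projection :: "'a \<Rightarrow> 'x" where "orbit_projection g \<equiv> projection (\<phi> g x)"

lemma H_carrier: "h \<in> H \<Longrightarrow> h \<in> carrier G"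
  using subgroup.mem_carrier[OF subgroup_H] .

lemma d_commute: "g \<in> carrier G \<Longrightarrow> h \<in> carrier G \<Longrightarrow> d g h = d h g"
  using word_dist_commute[OF S_carrier] generate_S by auto

lemma d_triangle: "g \<in> carrier G \<Longrightarrow> h \<in> carrier G \<Longrightarrow> k \<in> carrier G \<Longrightarrow> d g k \<le> d g h + d h k"
  using word_dist_triangle[OF S_carrier] generate_S by auto

lemma finite_d_ball: "finite {g \<in> carrier G. d \<one> g \<le> r}"
proof (rule finite_subset)
  show "{g \<in> carrier G. d \<one> g \<le> r} \<subseteq> {g \<in> generate G S. word_length G S g \<le> nat \<lfloor>r\<rfloor>}"
    using generate_S by (auto simp: word_dist_def le_nat_floor)
qed (rule finite_word_ball[OF finite_S S_carrier])

lemma one_mem_H: "\<one> \<in> H"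
  by (rule subgroup.one_closed[OF subgroup_H])

lemma x_mem_Q: "x \<in> Q"
  unfolding Q_def by (rule image_eqI[OF _ one_mem_H]) (simp add: act_one)

lemma projection: "projection y \<in> Q" "dist y (projection y) \<le> infdist y Q + 1"
proof -
  obtain z where "z \<in> Q" "dist y z < infdist y Q + 1"
    using infdist_attains_almost[of Q y "infdist y Q + 1"] x_mem_Q by auto
  then have "\<exists>p. p \<in> Q \<and> dist y p \<le> infdist y Q + 1" by (intro exI[of _ z]) auto
  then have "projection y \<in> Q \<and> dist y (projection y) \<le> infdist y Q + 1"
    unfolding projection_def by (rule someI_ex)
  then show "projection y \<in> Q" "dist y (projection y) \<le> infdist y Q + 1" by auto
qed

lemma projection_contracting:
  obtains D where "0 \<le> D" "\<And>y y'. dist y y' \<le> infdist y Q \<Longrightarrow> dist (projection y) (projection y') \<le> D"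
    "\<And>y y'. dist (projection y) (projection y') \<le> dist y y' + D"
proof -
  obtain \<sigma> where \<sigma>: "0 \<le> \<sigma>" "quasiconvex \<sigma> Q"
    using linearly_chained_imp_quasiconvex[OF hyperbolic A_ge_1, of A] A_ge_1 orbit_chained
    unfolding Q_def by auto
  define D where "D = 10 * \<delta> + 4 * \<sigma> + 4"
  have *: "dist (projection y) (projection y') \<le> max 0 (dist y y' - dist y (projection y)) + D" for y y'
    using near_projection_contracting[OF geodesic hyperbolic \<sigma>(2,1) projection projection]
    by (simp add: D_def algebra_simps)
  show ?thesis
  proof
    show "0 \<le> D" using \<sigma>(1) hyperbolic(2) by (simp add: D_def)
    fix y y'
    show "dist (projection y) (projection y') \<le> D" if "dist y y' \<le> infdist y Q"
      using *[of y y'] that infdist_le[OF projection(1), of y y] by (simp add: max_def split: if_splits)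
    have "max 0 (dist y y' - dist y (projection y)) \<le> dist y y'" by simp
    then show "dist (projection y) (projection y') \<le> dist y y' + D"
      using *[of y y'] by linarith
  qed
qed

text \<open>
  Two elements \<open>k\<close>, \<open>l\<close> of the set below send the pair \<open>(x, w x)\<close> close to \<open>(x, u x)\<close>, so
  \<open>k l\<^sup>-\<^sup>1\<close> almost fixes both \<open>x\<close> and \<open>u x\<close>.
\<close>

lemma finite_coarse_transporter:
  assumes \<epsilon>: "0 \<le> \<epsilon>" and w: "w \<in> carrier G" and u: "u \<in> H"
    and fin: "finite {g \<in> carrier G. dist (\<phi> g x) x \<le> 2 * \<epsilon> \<and> dist (\<phi> g (\<phi> u x)) (\<phi> u x) \<le> 2 * \<epsilon>}"
  shows "finite {k \<in> carrier G. dist (\<phi> k x) x \<le> \<epsilon> \<and> dist (\<phi> (k \<otimes> w) x) (\<phi> u x) \<le> \<epsilon>}" (is "finite ?Z")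
proof (cases "?Z = {}")
  case False
  then obtain l where l: "l \<in> ?Z" by blast
  have move: "dist (\<phi> (k \<otimes> inv l) z) z \<le> 2 * \<epsilon>"
    if "k \<in> carrier G" "dist (\<phi> k y) z \<le> \<epsilon>" "dist (\<phi> l y) z \<le> \<epsilon>" for k y z
  proof -
    have lc: "l \<in> carrier G" using l by simp
    have "\<phi> (inv l) (\<phi> l y) = y" using act_mult[of "inv l" l] act_one lc by simp
    then have "dist (\<phi> (inv l) z) y = dist z (\<phi> l y)" using act_isometry[of "inv l" z "\<phi> l y"] lc by simp
    then have "dist (\<phi> (k \<otimes> inv l) z) (\<phi> k y) \<le> \<epsilon>"
      using that act_isometry[of k "\<phi> (inv l) z" y] lc by (simp add: act_mult dist_commute)
    then show ?thesis using that dist_triangle[of "\<phi> (k \<otimes> inv l) z" z "\<phi> k y"] by linarith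
  qed
  have "(\<lambda>k. k \<otimes> inv l) ` ?Z \<subseteq>
    {g \<in> carrier G. dist (\<phi> g x) x \<le> 2 * \<epsilon> \<and> dist (\<phi> g (\<phi> u x)) (\<phi> u x) \<le> 2 * \<epsilon>}"
    using l w move[of _ x x] move[of _ "\<phi> w x" "\<phi> u x"] by (auto simp: act_mult)
  then have "finite ((\<lambda>k. k \<otimes> inv l) ` ?Z)" using fin by (rule finite_subset)
  moreover have "inj_on (\<lambda>k. k \<otimes> inv l) ?Z" using l by (auto intro!: inj_onI)
  ultimately show ?thesis by (rule finite_imageD)
next
  case True
  then show ?thesis by (simp only: finite.emptyI)
qed

text \<open>Translation by the inverse of \<open>h\<close> moves the situation to the base point.
  Then \<open>g'\<close> differs from \<open>g\<close> by one of finitely many \<open>w\<close>, and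
  \<open>h'\<close> from \<open>h\<close> by one of finitely many \<open>u\<close>, because
  \<open>dist (\<phi> h x) (\<phi> h' x)\<close> is bounded. For each pair acylindricity at
  \<open>x\<close> and \<open>\<phi> u x\<close> leaves finitely many positions of \<open>g\<close>.
  It matters that \<open>R\<close> is fixed before \<open>P\<close>; only \<open>r\<close> depends
  on \<open>P\<close>.\<close>

lemma near_orbit_imp_near_subgroup:
  assumes \<epsilon>: "0 \<le> \<epsilon>"
  obtains R where "0 < R" "\<And>P. \<exists>r. \<forall>g g' h h'. g \<in> carrier G \<longrightarrow> g' \<in> carrier G \<longrightarrow> h \<in> H \<longrightarrow> h' \<in> H \<longrightarrow>
    d g g' \<le> P \<longrightarrow> dist (\<phi> g x) (\<phi> h x) \<le> \<epsilon> \<longrightarrow> dist (\<phi> g' x) (\<phi> h' x) \<le> \<epsilon> \<longrightarrow>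
    R \<le> dist (\<phi> h x) (\<phi> h' x) \<longrightarrow> d g h \<le> r"
proof -
  obtain R where "0 < R" and R: "\<And>y z. y \<in> Q \<Longrightarrow> z \<in> Q \<Longrightarrow> R \<le> dist y z \<Longrightarrow>
    finite {g \<in> carrier G. dist (\<phi> g y) y \<le> 2 * \<epsilon> \<and> dist (\<phi> g z) z \<le> 2 * \<epsilon>}"
  proof -
    have "0 \<le> 2 * \<epsilon>" using \<epsilon> by simp
    then obtain R :: real where R: "0 < R" "\<exists>M>0::nat. \<forall>y\<in>Q. \<forall>z\<in>Q. dist y z \<ge> R \<longrightarrow>
        finite {g \<in> carrier G. dist (\<phi> g y) y \<le> 2 * \<epsilon> \<and> dist (\<phi> g z) z \<le> 2 * \<epsilon>} \<and>
        card {g \<in> carrier G. dist (\<phi> g y) y \<le> 2 * \<epsilon> \<and> dist (\<phi> g z) z \<le> 2 * \<epsilon>} \<le> M"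
      using acylindrical unfolding acylindrical_along_set_def Q_def[symmetric] by blast
    then show ?thesis using that by blast
  qed
  have "\<exists>r. \<forall>g g' h h'. g \<in> carrier G \<longrightarrow> g' \<in> carrier G \<longrightarrow> h \<in> H \<longrightarrow> h' \<in> H \<longrightarrow>
    d g g' \<le> P \<longrightarrow> dist (\<phi> g x) (\<phi> h x) \<le> \<epsilon> \<longrightarrow> dist (\<phi> g' x) (\<phi> h' x) \<le> \<epsilon> \<longrightarrow>
    R \<le> dist (\<phi> h x) (\<phi> h' x) \<longrightarrow> d g h \<le> r" for P
  proof -
    define Z where "Z w u = {k \<in> carrier G. dist (\<phi> k x) x \<le> \<epsilon> \<and> dist (\<phi> (k \<otimes> w) x) (\<phi> u x) \<le> \<epsilon>}" for w u
    define W where "W = {w \<in> carrier G. d \<one> w \<le> P}"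
    define U where "U = {u \<in> H. d \<one> u \<le> A * (2 * \<epsilon> + A * P + 1) \<and> R \<le> dist x (\<phi> u x)}"
    define K where "K = (\<Union>w\<in>W. \<Union>u\<in>U. Z w u)"
    have "finite U"
      by (rule finite_subset[OF _ finite_d_ball[of "A * (2 * \<epsilon> + A * P + 1)"]])
        (auto simp: U_def H_carrier)
    moreover have "finite W" unfolding W_def by (rule finite_d_ball)
    moreover have "finite (Z w u)" if "w \<in> W" "u \<in> U" for w u
      unfolding Z_def using that R[OF x_mem_Q, of "\<phi> u x"]
      by (intro finite_coarse_transporter \<epsilon>) (auto simp: W_def U_def Q_def)
    ultimately have "finite K" unfolding K_def by blast
    define r where "r = Max (insert 0 ((\<lambda>k. d k \<one>) ` K))"
    have r: "d k \<one> \<le> r" if "k \<in> K" for k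
      unfolding r_def by (rule Max_ge) (use that \<open>finite K\<close> in auto)
    have "d g h \<le> r"
      if car: "g \<in> carrier G" "g' \<in> carrier G" and hH: "h \<in> H" "h' \<in> H" and P: "d g g' \<le> P"
        and near: "dist (\<phi> g x) (\<phi> h x) \<le> \<epsilon>" "dist (\<phi> g' x) (\<phi> h' x) \<le> \<epsilon>"
        and far: "R \<le> dist (\<phi> h x) (\<phi> h' x)" for g g' h h'
    proof -
      have hc: "h \<in> carrier G" "h' \<in> carrier G" using hH H_carrier by auto
      \<comment> \<open>The position of \<open>g\<close> relative to \<open>h\<close>; its word
        length is \<open>d g h\<close>, so a finite list of values of \<open>k\<close> bounds that
        distance.\<close>
      define k where "k = inv h \<otimes> g"
      define w where "w = inv g \<otimes> g'"
      define u where "u = inv h \<otimes> h'"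
      have kwu: "k \<in> carrier G" "w \<in> carrier G" "u \<in> H"
        using car hc hH subgroup_H
        by (auto simp: k_def w_def u_def subgroup.m_inv_closed subgroup.m_closed)
      have shift: "dist (\<phi> (inv h \<otimes> a) x) (\<phi> (inv h \<otimes> b) x) = dist (\<phi> a x) (\<phi> b x)"
        if "a \<in> carrier G" "b \<in> carrier G" for a b
        using that hc by (simp add: act_mult act_isometry)
      have kw: "k \<otimes> w = inv h \<otimes> g'" using car hc by (simp add: k_def w_def m_assoc inv_mult_cancel)
      have "dist (\<phi> k x) x \<le> \<epsilon>"
        using shift[OF car(1) hc(1)] near(1) hc act_one by (simp add: k_def)
      moreover have "dist (\<phi> (k \<otimes> w) x) (\<phi> u x) \<le> \<epsilon>"
        using shift[OF car(2) hc(2)] near(2) by (simp add: kw u_def)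
      ultimately have "k \<in> Z w u" using kwu by (simp add: Z_def)
      moreover have "w \<in> W" using P kwu(2) by (simp add: W_def w_def word_dist_def car)
      moreover have "u \<in> U"
      proof -
        have "dist (\<phi> h x) (\<phi> h' x) \<le> dist (\<phi> g x) (\<phi> h x) + dist (\<phi> g x) (\<phi> g' x) + dist (\<phi> g' x) (\<phi> h' x)"
          using dist_triangle[of "\<phi> h x" "\<phi> h' x" "\<phi> g x"] dist_triangle[of "\<phi> g x" "\<phi> h' x" "\<phi> g' x"]
          by (simp add: dist_commute)
        also have "\<dots> \<le> 2 * \<epsilon> + A * P"
        proof -
          have "A * d g g' \<le> A * P" using P A_ge_1 by (intro mult_left_mono) auto
          then show ?thesis using near orbit_lipschitz[OF car] by linarith
        qed
        finally have le: "dist (\<phi> h x) (\<phi> h' x) \<le> 2 * \<epsilon> + A * P" .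
        have "d \<one> u = d h h'" using kwu hc H_carrier by (simp add: word_dist_def u_def)
        also have "\<dots> \<le> A * (2 * \<epsilon> + A * P + 1)"
          using le A_ge_1 by (intro order_trans[OF orbit_coarse_inverse[OF hH]] mult_left_mono) auto
        finally have "d \<one> u \<le> A * (2 * \<epsilon> + A * P + 1)" .
        moreover have "R \<le> dist x (\<phi> u x)"
          using far shift[OF hc] hc act_one by (simp add: u_def)
        ultimately show ?thesis using kwu(3) by (simp add: U_def)
      qed
      ultimately have "k \<in> K" by (auto simp: K_def)
      moreover have "d k \<one> = d g h"
        using car hc kwu(1) by (simp add: word_dist_def k_def inv_mult_group)
      ultimately show ?thesis using r by force
    qed
    then show ?thesis by blast
  qed
  then show ?thesis using that \<open>0 < R\<close> by blast
qed

lemma d_chain: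
  assumes "\<And>i. a \<le> i \<Longrightarrow> i \<le> a + k \<Longrightarrow> g i \<in> carrier G"
    and "\<And>i. a \<le> i \<Longrightarrow> i < a + k \<Longrightarrow> d (g i) (g (Suc i)) \<le> \<nu>"
  shows "d (g a) (g (a + k)) \<le> real k * \<nu>"
  using assms
proof (induction k)
  case 0
  then show ?case by (simp add: word_dist_self)
next
  case (Suc k)
  have "d (g a) (g (a + k)) \<le> real k * \<nu>" by (intro Suc.IH Suc.prems) auto
  moreover have "d (g (a + k)) (g (Suc (a + k))) \<le> \<nu>" by (intro Suc.prems) auto
  moreover have "d (g a) (g (Suc (a + k))) \<le> d (g a) (g (a + k)) + d (g (a + k)) (g (Suc (a + k)))"
    by (intro d_triangle Suc.prems) auto
  ultimately show ?case by (simp add: algebra_simps)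
qed

section \<open>Slow progress of the projection along paths far from the subgroup\<close>

definition far_path :: "real \<Rightarrow> real \<Rightarrow> nat \<Rightarrow> (nat \<Rightarrow> 'a) \<Rightarrow> bool" where
  "far_path r \<nu> k g \<longleftrightarrow> (\<forall>i\<le>k. g i \<in> carrier G \<and> (\<forall>h\<in>H. r < d (g i) h)) \<and>
     (\<forall>i<k. d (g i) (g (Suc i)) \<le> \<nu>)"

lemma orbit_step:
  assumes "g \<in> carrier G" "h \<in> carrier G" "d g h \<le> \<nu>"
  shows "dist (\<phi> g x) (\<phi> h x) \<le> A * \<nu>"
proof -
  have "A * d g h \<le> A * \<nu>" using assms A_ge_1 by (intro mult_left_mono) auto
  then show ?thesis using orbit_lipschitz[OF assms(1,2)] by linarith
qed

text \<open>
  The order of choices is what makes the rate \<open>c\<close> arbitrary: \<open>m\<close> (hence \<open>\<epsilon>\<close>) makes the part of the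
  block far from \<open>Q\<close> slow, \<open>\<epsilon>\<close> determines \<open>R\<close>, the length \<open>N\<close> absorbs \<open>R\<close>, and only then \<open>r\<close> is
  chosen for \<open>N\<close>. The part of the block between its first and last visit near \<open>Q\<close> progresses by at
  most \<open>R\<close>, since otherwise the first visit would be \<open>r\<close>-close to \<open>H\<close>.
\<close>

lemma far_block_projection:
  assumes c: "0 < c" and \<nu>: "0 \<le> \<nu>"
  obtains N r where "1 \<le> N"
    "\<And>g. far_path r \<nu> N g \<Longrightarrow> dist (orbit_projection (g 0)) (orbit_projection (g N)) \<le> c * real N"
proof -
  obtain D where D: "0 \<le> D" "\<And>y y'. dist y y' \<le> infdist y Q \<Longrightarrow> dist (projection y) (projection y') \<le> D"
    "\<And>y y'. dist (projection y) (projection y') \<le> dist y y' + D"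
    by (rule projection_contracting) (rule that)
  define \<mu> where "\<mu> = A * \<nu>"
  have \<mu>: "0 \<le> \<mu>" using \<nu> A_ge_1 by (simp add: \<mu>_def)
  \<comment> \<open>Two stretches far from \<open>Q\<close> each progress at rate
    \<open>D / m\<close>; this \<open>m\<close> keeps their sum below half of the allowed rate
    \<open>c\<close>. The constants left over are absorbed in the other half by
    \<open>N\<close>.\<close>
  define m where "m = nat \<lceil>4 * D / c\<rceil> + 1"
  have "4 * D / c \<le> real m" unfolding m_def by linarith
  then have m: "1 \<le> m" "2 * D / real m \<le> c / 2" using c by (auto simp: m_def field_simps)
  \<comment> \<open>The summand \<open>1\<close> is the slack in the choice of the projection, so a
    point within \<open>real m * \<mu>\<close> of \<open>Q\<close> is
    \<open>\<epsilon>\<close>-close to its projection.\<close>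
  define \<epsilon> where "\<epsilon> = real m * \<mu> + 1"
  have \<epsilon>: "0 \<le> \<epsilon>" using \<mu> by (simp add: \<epsilon>_def)
  obtain R where R: "0 < R" "\<And>P. \<exists>r. \<forall>g g' h h'. g \<in> carrier G \<longrightarrow> g' \<in> carrier G \<longrightarrow> h \<in> H \<longrightarrow> h' \<in> H \<longrightarrow>
      d g g' \<le> P \<longrightarrow> dist (\<phi> g x) (\<phi> h x) \<le> \<epsilon> \<longrightarrow> dist (\<phi> g' x) (\<phi> h' x) \<le> \<epsilon> \<longrightarrow>
      R \<le> dist (\<phi> h x) (\<phi> h' x) \<longrightarrow> d g h \<le> r"
    using near_orbit_imp_near_subgroup[OF \<epsilon>] by blast
  define N where "N = nat \<lceil>2 * (4 * D + 2 * \<mu> + R) / c\<rceil> + 1"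
  have "2 * (4 * D + 2 * \<mu> + R) / c \<le> real N" unfolding N_def by linarith
  then have N: "1 \<le> N" "4 * D + 2 * \<mu> + R \<le> c * real N / 2" using c by (auto simp: N_def field_simps)
  obtain r where r: "\<And>g g' h h'. g \<in> carrier G \<Longrightarrow> g' \<in> carrier G \<Longrightarrow> h \<in> H \<Longrightarrow> h' \<in> H \<Longrightarrow>
      d g g' \<le> real N * \<nu> \<Longrightarrow> dist (\<phi> g x) (\<phi> h x) \<le> \<epsilon> \<Longrightarrow> dist (\<phi> g' x) (\<phi> h' x) \<le> \<epsilon> \<Longrightarrow>
      R \<le> dist (\<phi> h x) (\<phi> h' x) \<Longrightarrow> d g h \<le> r"
    using R(2)[of "real N * \<nu>"] by blast
  have "dist (orbit_projection (g 0)) (orbit_projection (g N)) \<le> c * real N" if g: "far_path r \<nu> N g" for g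
  proof -
    define f where "f i = \<phi> (g i) x" for i
    have car: "g i \<in> carrier G" if "i \<le> N" for i using g that by (auto simp: far_path_def)
    have step: "dist (f i) (f (Suc i)) \<le> \<mu>" if "i < N" for i
      unfolding f_def \<mu>_def using g that by (intro orbit_step) (auto simp: far_path_def)
    define J where "J = {j. j \<le> N \<and> infdist (f j) Q < real m * \<mu>}"
    define E where "E = D * (real N / real m + 1)"
    have E: "0 \<le> E" using D(1) by (simp add: E_def)
    have segment: "dist (projection (f a)) (projection (f b)) \<le> E"
      if ab: "a \<le> b" "b \<le> N" "\<And>i. a \<le> i \<Longrightarrow> i \<le> b \<Longrightarrow> i \<notin> J" for a b
    proof -
      have "dist (projection (f a)) (projection (f (a + (b - a)))) \<le> D * (real (b - a) / real m + 1)"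
      proof (rule projection_of_distant_chain[where f = f and p = projection and \<mu> = \<mu> and Q = Q])
        show "real m * \<mu> \<le> infdist (f i) Q" if "a \<le> i" "i \<le> a + (b - a)" for i
          using ab(3)[of i] that ab(1,2) by (auto simp: J_def not_less)
      qed (use D \<mu> m step ab in auto)
      also have "\<dots> \<le> E" unfolding E_def using ab D(1)
        by (intro mult_left_mono add_right_mono divide_right_mono) auto
      finally show ?thesis using ab by simp
    qed
    have proj_step: "dist (projection (f i)) (projection (f (Suc i))) \<le> \<mu> + D" if "i < N" for i
      using D(3)[of "f i" "f (Suc i)"] step[OF that] by simp
    have "dist (projection (f 0)) (projection (f N)) \<le> 2 * (E + \<mu> + D) + R"
    proof (cases "J = {}")
      case True
      then show ?thesis using segment[of 0 N] E \<mu> D(1) R(1) by simp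
    next
      case False
      have "finite J" by (simp add: J_def)
      define j where "j = Min J"
      define j' where "j' = Max J"
      have jJ: "j \<in> J" "j' \<in> J" and jmin: "\<And>i. i \<in> J \<Longrightarrow> j \<le> i" and jmax: "\<And>i. i \<in> J \<Longrightarrow> i \<le> j'"
        using \<open>finite J\<close> False by (auto simp: j_def j'_def)
      have jj: "j \<le> j'" "j' \<le> N" using jmin[OF jJ(2)] jJ by (auto simp: J_def)
      \<comment> \<open>The stretch avoiding \<open>J\<close> stops one index before
        \<open>j\<close>; the step into \<open>J\<close> is paid by the coarse Lipschitz bound
        \<open>\<mu> + D\<close>. The same happens after \<open>j'\<close>.\<close>
      have "dist (projection (f 0)) (projection (f j)) \<le> E + (\<mu> + D)"
      proof (cases j)
        case 0
        then show ?thesis using E \<mu> D(1) by simp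
      next
        case (Suc i)
        then have "dist (projection (f 0)) (projection (f i)) \<le> E"
          using jj jmin by (intro segment) fastforce+
        then show ?thesis using proj_step[of i] Suc jj
            dist_triangle[of "projection (f 0)" "projection (f j)" "projection (f i)"] by simp
      qed
      moreover have "dist (projection (f j')) (projection (f N)) \<le> E + (\<mu> + D)"
      proof (cases "j' = N")
        case True
        then show ?thesis using E \<mu> D(1) by simp
      next
        case False
        then have "dist (projection (f (Suc j'))) (projection (f N)) \<le> E"
          using jj jmax by (intro segment) fastforce+
        then show ?thesis using proj_step[of j'] False jj
            dist_triangle[of "projection (f j')" "projection (f N)" "projection (f (Suc j'))"] by simp
      qed
      moreover have "dist (projection (f j)) (projection (f j')) < R"
      proof (rule ccontr)
        assume "\<not> ?thesis"
        moreover obtain h h' where h: "h \<in> H" "h' \<in> H" "projection (f j) = \<phi> h x" "projection (f j') = \<phi> h' x"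
          using projection(1)[of "f j"] projection(1)[of "f j'"] unfolding Q_def by blast
        moreover have "dist (f j) (projection (f j)) \<le> \<epsilon>" "dist (f j') (projection (f j')) \<le> \<epsilon>"
          using projection(2)[of "f j"] projection(2)[of "f j'"] jJ by (auto simp: J_def \<epsilon>_def)
        moreover have "d (g j) (g j') \<le> real N * \<nu>"
        proof -
          have "d (g j) (g (j + (j' - j))) \<le> real (j' - j) * \<nu>"
            using g jj by (intro d_chain) (auto simp: far_path_def)
          also have "\<dots> \<le> real N * \<nu>" using jj \<nu> by (intro mult_right_mono) auto
          finally show ?thesis using jj by simp
        qed
        ultimately have "d (g j) h \<le> r" using jj car by (intro r[of "g j" "g j'" h h']) (auto simp: f_def)
        moreover have "r < d (g j) h" using g jj h by (auto simp: far_path_def)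
        ultimately show False by simp
      qed
      ultimately show ?thesis
        using dist_triangle[of "projection (f 0)" "projection (f N)" "projection (f j)"]
          dist_triangle[of "projection (f j)" "projection (f N)" "projection (f j')"]
        by (simp add: distrib_left)
    qed
    also have "\<dots> = 2 * D / real m * real N + (4 * D + 2 * \<mu> + R)"
      by (simp add: E_def algebra_simps)
    also have "\<dots> \<le> c / 2 * real N + c * real N / 2"
      using m N by (intro add_mono mult_right_mono) auto
    finally show ?thesis by (simp add: f_def)
  qed
  then show ?thesis by (rule that[OF N(1)])
qed

text \<open>The bound for a block has no additive term, so blocks can be concatenated without
  accumulating errors. The constant \<open>C\<close> covers only the last, incomplete block.\<close>

lemma far_path_projection:
  assumes c: "0 < c" and \<nu>: "0 \<le> \<nu>"
  obtains r C where "0 \<le> C"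
    "\<And>g k. far_path r \<nu> k g \<Longrightarrow> dist (orbit_projection (g 0)) (orbit_projection (g k)) \<le> c * real k + C"
proof -
  obtain D where D: "0 \<le> D" "\<And>y y'. dist (projection y) (projection y') \<le> dist y y' + D"
    by (rule projection_contracting) (rule that)
  obtain N r where N: "1 \<le> N" and
    Nr: "\<And>g. far_path r \<nu> N g \<Longrightarrow> dist (orbit_projection (g 0)) (orbit_projection (g N)) \<le> c * real N"
    by (rule far_block_projection[OF assms]) (rule that)
  define C where "C = real N * (A * \<nu>) + D"
  have nonneg: "0 \<le> A * \<nu>" using \<nu> A_ge_1 by simp
  have "dist (orbit_projection (g 0)) (orbit_projection (g k)) \<le> c * real k + C" if "far_path r \<nu> k g" for g k
    using that
  proof (induction k arbitrary: g rule: less_induct)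
    case (less k)
    show ?case
    proof (cases "k < N")
      case True
      have "dist (\<phi> (g 0) x) (\<phi> (g (0 + k)) x) \<le> real k * (A * \<nu>)"
        using less.prems by (intro dist_chain[of 0 k "\<lambda>i. \<phi> (g i) x"] orbit_step) (auto simp: far_path_def)
      also have "\<dots> \<le> real N * (A * \<nu>)" using True nonneg by (intro mult_right_mono) auto
      finally have "dist (orbit_projection (g 0)) (orbit_projection (g k)) \<le> C"
        using D(2)[of "\<phi> (g 0) x" "\<phi> (g k) x"] by (simp add: C_def)
      then show ?thesis using c by (simp add: add_increasing)
    next
      case False
      have "dist (orbit_projection (g 0)) (orbit_projection (g N)) \<le> c * real N"
        using less.prems False by (intro Nr) (auto simp: far_path_def)
      moreover have "dist (orbit_projection ((\<lambda>i. g (N + i)) 0)) (orbit_projection ((\<lambda>i. g (N + i)) (k - N)))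
          \<le> c * real (k - N) + C"
        using less.prems False N by (intro less.IH) (auto simp: far_path_def)
      moreover have "c * real N + c * real (k - N) = c * real k"
        using False by (simp add: algebra_simps of_nat_diff)
      ultimately show ?thesis using False
          dist_triangle[of "orbit_projection (g 0)" "orbit_projection (g k)" "orbit_projection (g N)"]
        by simp
    qed
  qed
  moreover have "0 \<le> C" using nonneg D(1) by (simp add: C_def)
  ultimately show ?thesis by (rule that[rotated])
qed

section \<open>Bounded excursions and stability for sequences\<close>

text \<open>An excursion from time \<open>a\<close> to time \<open>b\<close> starts and ends near
  \<open>H\<close>, where distances in \<open>G\<close> are controlled by distances of projections.
  Its slow projection then contradicts the linear lower bound for \<open>d (g a) (g b)\<close>
  unless \<open>b - a\<close> is bounded. The ends are allowed to lie at distance \<open>1\<close>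
  from \<open>H\<close> because points of the Cayley graph will be rounded to vertices.\<close>

lemma quasi_geodesic_near_subgroup:
  assumes \<kappa>: "1 \<le> \<kappa>"
  obtains L where "0 \<le> L"
    "\<And>n g i. discrete_quasi_geodesic d \<kappa> n g \<Longrightarrow> (\<And>j. j \<le> n \<Longrightarrow> g j \<in> carrier G) \<Longrightarrow>
      \<exists>h\<in>H. d (g 0) h \<le> 1 \<Longrightarrow> \<exists>h\<in>H. d (g n) h \<le> 1 \<Longrightarrow> i \<le> n \<Longrightarrow> \<exists>h\<in>H. d (g i) h \<le> L"
proof -
  obtain D where D: "0 \<le> D" "\<And>y y'. dist (projection y) (projection y') \<le> dist y y' + D"
    by (rule projection_contracting) (rule that)
  \<comment> \<open>After multiplication by \<open>A\<close> this rate is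
    \<open>1 / (2 * \<kappa>)\<close>, half of the rate at which the quasi-geodesic must
    progress.\<close>
  define c where "c = 1 / (2 * \<kappa> * A)"
  have c: "0 < c" using \<kappa> A_ge_1 by (simp add: c_def)
  obtain r0 C where C: "0 \<le> C" "\<And>g k. far_path r0 (2 * \<kappa>) k g \<Longrightarrow>
      dist (orbit_projection (g 0)) (orbit_projection (g k)) \<le> c * real k + C"
  proof -
    have "0 \<le> 2 * \<kappa>" using \<kappa> by simp
    from far_path_projection[OF c this] that show ?thesis .
  qed
  define r where "r = max r0 1"
  \<comment> \<open>Two comparisons of an orbit point with a projection, two single steps at the
    boundary of the excursion, and the constant of the far path.\<close>
  define C1 where "C1 = 2 * (1 + A * r + D) + 2 * (2 * A * \<kappa> + D) + C"
  define C2 where "C2 = 2 * r + A * (C1 + 1)"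
  define B where "B = 2 * \<kappa> * (C2 + \<kappa>)"
  define L where "L = \<kappa> * B + \<kappa> + r"
  have "0 \<le> C1" using C(1) D(1) A_ge_1 \<kappa> by (simp add: C1_def r_def)
  then have "0 \<le> C2" using A_ge_1 by (simp add: C2_def r_def)
  then have "0 \<le> \<kappa> * B" using \<kappa> by (simp add: B_def)
  then have L: "0 \<le> L" "r \<le> L" using \<kappa> by (auto simp: L_def r_def)
  have "\<exists>h\<in>H. d (g i) h \<le> L"
    if qg: "discrete_quasi_geodesic d \<kappa> n g" and car: "\<And>j. j \<le> n \<Longrightarrow> g j \<in> carrier G"
      and ends: "\<exists>h\<in>H. d (g 0) h \<le> 1" "\<exists>h\<in>H. d (g n) h \<le> 1" and i: "i \<le> n" for n g i
  proof (cases "\<exists>h\<in>H. d (g i) h \<le> r")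
    case True
    then show ?thesis using L(2) by force
  next
    case far: False
    define near where "near j \<longleftrightarrow> (\<exists>h\<in>H. d (g j) h \<le> r)" for j
    have near_ends: "near 0" "near n" using ends by (force simp: near_def r_def)+
    \<comment> \<open>The excursion around \<open>i\<close> is delimited by the last near time
      before it and the first one after it; both exist because the ends of the sequence are
      near.\<close>
    define a where "a = Max {j. j \<le> i \<and> near j}"
    define b where "b = Min {j. i \<le> j \<and> j \<le> n \<and> near j}"
    have "a \<in> {j. j \<le> i \<and> near j}" unfolding a_def using near_ends by (intro Max_in) auto
    then have a: "a < i" "near a" using far by (auto simp: near_def le_less)
    have "b \<in> {j. i \<le> j \<and> j \<le> n \<and> near j}" unfolding b_def using near_ends i by (intro Min_in) auto
    then have b: "i < b" "b \<le> n" "near b" using far by (auto simp: near_def le_less)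
    have between: "\<not> near j" if "a < j" "j < b" for j
    proof
      assume "near j"
      show False
      proof (cases "j \<le> i")
        case True
        then have "j \<le> a" unfolding a_def using \<open>near j\<close> by (intro Max_ge) auto
        then show ?thesis using that by simp
      next
        case False
        then have "b \<le> j" unfolding b_def using \<open>near j\<close> that b by (intro Min_le) auto
        then show ?thesis using that by simp
      qed
    qed
    have step: "d (g j) (g (Suc j)) \<le> 2 * \<kappa>" if "j < n" for j
      using discrete_quasi_geodesicD(2)[OF qg, of j "Suc j"] that by simp
    have proj_step: "dist (orbit_projection (g j)) (orbit_projection (g (Suc j))) \<le> 2 * A * \<kappa> + D" if "j < n" for j
      using D(2)[of "\<phi> (g j) x" "\<phi> (g (Suc j)) x"] orbit_step[OF car car step, of j] that by simp
    \<comment> \<open>Only indices strictly between \<open>a\<close> and \<open>b\<close> are far,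
      so the far path runs from \<open>Suc a\<close> to \<open>Suc (a + k)\<close>. The subtraction
      does not truncate since \<open>a < i < b\<close>.\<close>
    define k where "k = b - a - 2"
    have k: "b = Suc (Suc (a + k))" using a b by (simp add: k_def)
    have "far_path r0 (2 * \<kappa>) k (\<lambda>j. g (Suc a + j))"
      unfolding far_path_def
    proof (intro conjI allI impI ballI)
      fix j h assume "j \<le> k" "h \<in> H"
      then have "\<not> d (g (Suc a + j)) h \<le> r" using between[of "Suc a + j"] k by (auto simp: near_def)
      then show "r0 < d (g (Suc a + j)) h" by (simp add: r_def)
    qed (use car step b k in auto)
    from C(2)[OF this]
    have middle: "dist (orbit_projection (g (Suc a))) (orbit_projection (g (Suc (a + k)))) \<le> c * real k + C" by simp
    have near_proj: "dist (\<phi> h x) (orbit_projection (g j)) \<le> 1 + A * r + D"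
      if "h \<in> H" "d (g j) h \<le> r" "j \<le> n" for h j
    proof -
      have "\<phi> h x \<in> Q" using that by (simp add: Q_def)
      then have "dist (\<phi> h x) (orbit_projection h) \<le> 1" using projection(2)[of "\<phi> h x"] by simp
      moreover have "dist (\<phi> (g j) x) (\<phi> h x) \<le> A * r" using that car H_carrier by (intro orbit_step) auto
      ultimately show ?thesis using D(2)[of "\<phi> h x" "\<phi> (g j) x"]
          dist_triangle[of "\<phi> h x" "orbit_projection (g j)" "orbit_projection h"] by (simp add: dist_commute)
    qed
    obtain ha where ha: "ha \<in> H" "d (g a) ha \<le> r" using a by (auto simp: near_def)
    obtain hb where hb: "hb \<in> H" "d (g b) hb \<le> r" using b by (auto simp: near_def)
    have ck: "c * real k \<le> c * (real b - real a)" using c k by (intro mult_left_mono) auto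
    have "dist (\<phi> ha x) (\<phi> hb x) \<le> dist (\<phi> ha x) (orbit_projection (g a))
        + dist (orbit_projection (g a)) (orbit_projection (g (Suc a)))
        + dist (orbit_projection (g (Suc a))) (orbit_projection (g (Suc (a + k))))
        + dist (orbit_projection (g (Suc (a + k)))) (orbit_projection (g b))
        + dist (\<phi> hb x) (orbit_projection (g b))"
      using dist_triangle[of "\<phi> ha x" "\<phi> hb x" "orbit_projection (g a)"]
        dist_triangle[of "orbit_projection (g a)" "\<phi> hb x" "orbit_projection (g (Suc a))"]
        dist_triangle[of "orbit_projection (g (Suc a))" "\<phi> hb x" "orbit_projection (g (Suc (a + k)))"]
        dist_triangle[of "orbit_projection (g (Suc (a + k)))" "\<phi> hb x" "orbit_projection (g b)"]
      unfolding dist_commute[of "\<phi> hb x" "orbit_projection (g b)"] by linarith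
    also have "\<dots> \<le> c * (real b - real a) + C1"
      using near_proj[OF ha] near_proj[OF hb] middle proj_step[of a] proj_step[of "Suc (a + k)"] a b i k ck
      by (simp add: C1_def)
    finally have hab: "dist (\<phi> ha x) (\<phi> hb x) \<le> c * (real b - real a) + C1" .
    have "d (g a) (g b) \<le> d (g a) ha + d ha hb + d (g b) hb"
      using d_triangle[of "g a" ha "g b"] d_triangle[of ha hb "g b"] d_commute[of hb "g b"]
        car[of a] car[of b] a b i H_carrier[OF ha(1)] H_carrier[OF hb(1)] by simp
    also have "\<dots> \<le> 2 * r + A * (c * (real b - real a) + C1 + 1)"
    proof -
      have "A * (dist (\<phi> ha x) (\<phi> hb x) + 1) \<le> A * (c * (real b - real a) + C1 + 1)"
        using hab A_ge_1 by (intro mult_left_mono) auto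
      then show ?thesis using orbit_coarse_inverse[OF ha(1) hb(1)] ha hb by linarith
    qed
    also have "\<dots> = (real b - real a) / (2 * \<kappa>) + C2"
    proof -
      have "A * (c * t) = t / (2 * \<kappa>)" for t using A_ge_1 \<kappa> by (simp add: c_def)
      then show ?thesis unfolding C2_def distrib_left by simp
    qed
    finally have "(real b - real a) / \<kappa> - \<kappa> \<le> (real b - real a) / (2 * \<kappa>) + C2"
      using discrete_quasi_geodesicD(1)[OF qg, of a b] a b i by simp
    moreover have "(real b - real a) / \<kappa> = (real b - real a) / (2 * \<kappa>) + (real b - real a) / (2 * \<kappa>)"
      by (simp add: field_simps)
    ultimately have "(real b - real a) / (2 * \<kappa>) \<le> C2 + \<kappa>" by linarith
    then have "real b - real a \<le> B" using \<kappa> by (simp add: B_def pos_divide_le_eq mult.commute)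
    then have "real i - real a \<le> B" using b by simp
    then have "\<kappa> * (real i - real a) \<le> \<kappa> * B" using \<kappa> by (intro mult_left_mono) auto
    then have "d (g i) (g a) \<le> \<kappa> * B + \<kappa>" using discrete_quasi_geodesicD(2)[OF qg, of i a] a i by simp
    then have "d (g i) ha \<le> L"
      using d_triangle[of "g i" "g a" ha] car[of a] car[of i] a i ha H_carrier by (simp add: L_def)
    then show ?thesis using ha(1) by blast
  qed
  then show ?thesis by (rule that[OF L(1)])
qed

text \<open>The Morse lemma is applied to nearby elements \<open>v (f i)\<close> of
  \<open>H\<close>, since only on \<open>H\<close> does distance in the orbit control distance in
  the group. Choosing \<open>v\<close> as a function of the group element keeps common endpoints
  common.\<close>

lemma discrete_stability:
  assumes \<kappa>: "1 \<le> \<kappa>"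
  obtains L where "\<And>n m f g i. discrete_quasi_geodesic d \<kappa> n f \<Longrightarrow> discrete_quasi_geodesic d \<kappa> m g \<Longrightarrow>
      (\<And>j. j \<le> n \<Longrightarrow> f j \<in> carrier G) \<Longrightarrow> (\<And>j. j \<le> m \<Longrightarrow> g j \<in> carrier G) \<Longrightarrow>
      f 0 = g 0 \<Longrightarrow> f n = g m \<Longrightarrow> \<exists>h\<in>H. d (f 0) h \<le> 1 \<Longrightarrow> \<exists>h\<in>H. d (f n) h \<le> 1 \<Longrightarrow>
      i \<le> n \<Longrightarrow> \<exists>j\<le>m. d (f i) (g j) \<le> L"
proof -
  obtain L1 where L1: "0 \<le> L1" and near:
    "\<And>n g i. discrete_quasi_geodesic d \<kappa> n g \<Longrightarrow> (\<And>j. j \<le> n \<Longrightarrow> g j \<in> carrier G) \<Longrightarrow>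
      \<exists>h\<in>H. d (g 0) h \<le> 1 \<Longrightarrow> \<exists>h\<in>H. d (g n) h \<le> 1 \<Longrightarrow> i \<le> n \<Longrightarrow> \<exists>h\<in>H. d (g i) h \<le> L1"
    by (rule quasi_geodesic_near_subgroup[OF \<kappa>]) (rule that, assumption, blast)
  \<comment> \<open>Dominates the rate \<open>A * \<kappa>\<close>, the additive error
    \<open>A * (\<kappa> + 2 * L1)\<close> of the upper bound, and the error
    \<open>\<kappa> + 2 * L1 + 1\<close> of the lower one.\<close>
  define \<kappa>' where "\<kappa>' = A * (\<kappa> + 2 * L1) + 1"
  have A\<kappa>: "A * \<kappa> \<le> \<kappa>'" "1 \<le> \<kappa>'" "\<kappa> + 2 * L1 + 1 \<le> \<kappa>'" "A * (\<kappa> + 2 * L1) \<le> \<kappa>'"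
  proof -
    have "1 * (\<kappa> + 2 * L1) \<le> A * (\<kappa> + 2 * L1)" using A_ge_1 \<kappa> L1 by (intro mult_right_mono) auto
    moreover have "0 \<le> A * L1" using A_ge_1 L1 by simp
    ultimately show "A * \<kappa> \<le> \<kappa>'" "1 \<le> \<kappa>'" "\<kappa> + 2 * L1 + 1 \<le> \<kappa>'" "A * (\<kappa> + 2 * L1) \<le> \<kappa>'"
      using \<kappa> L1 by (auto simp: \<kappa>'_def algebra_simps)
  qed
  obtain M where M: "\<forall>n m (f::nat \<Rightarrow> 'x) g. discrete_quasi_geodesic dist \<kappa>' n f \<longrightarrow>
    discrete_quasi_geodesic dist \<kappa>' m g \<longrightarrow> f 0 = g 0 \<longrightarrow> f n = g m \<longrightarrow>
    (\<forall>i\<le>n. \<exists>j\<le>m. dist (f i) (g j) \<le> M)"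
    using morse[OF geodesic hyperbolic \<open>1 \<le> \<kappa>'\<close>] by (elim exE conjE)
  define v where "v g = (SOME h. h \<in> H \<and> d g h \<le> L1)" for g
  have v: "v g \<in> H" "d g (v g) \<le> L1" if "\<exists>h\<in>H. d g h \<le> L1" for g
  proof -
    have "v g \<in> H \<and> d g (v g) \<le> L1" 
      unfolding v_def by (rule someI_ex) (use that in blast)
    then show "v g \<in> H" "d g (v g) \<le> L1" by auto
  qed
  have close: "d g k \<le> d (v g) (v k) + 2 * L1" "d (v g) (v k) \<le> d g k + 2 * L1"
    if "g \<in> carrier G" "k \<in> carrier G" "\<exists>h\<in>H. d g h \<le> L1" "\<exists>h\<in>H. d k h \<le> L1" for g k
  proof -
    have vc: "v g \<in> carrier G" "v k \<in> carrier G" using v that H_carrier by auto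
    have "d g k \<le> d g (v g) + d (v g) k" "d (v g) k \<le> d (v g) (v k) + d (v k) k"
      "d (v g) (v k) \<le> d (v g) g + d g (v k)" "d g (v k) \<le> d g k + d k (v k)"
      using that vc by (auto intro: d_triangle)
    moreover have "d (v g) g = d g (v g)" "d (v k) k = d k (v k)"
      using that vc by (auto intro: d_commute)
    ultimately show "d g k \<le> d (v g) (v k) + 2 * L1" "d (v g) (v k) \<le> d g k + 2 * L1"
      using v(2)[OF that(3)] v(2)[OF that(4)] by linarith+
  qed
  have image: "discrete_quasi_geodesic dist \<kappa>' n (\<lambda>i. \<phi> (v (f i)) x)"
    if qg: "discrete_quasi_geodesic d \<kappa> n f" and car: "\<And>j. j \<le> n \<Longrightarrow> f j \<in> carrier G"
      and nr: "\<And>i. i \<le> n \<Longrightarrow> \<exists>h\<in>H. d (f i) h \<le> L1" for n f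
    unfolding discrete_quasi_geodesic_def
  proof (intro allI impI conjI)
    fix i j assume ij: "i \<le> n" "j \<le> n"
    define t where "t = \<bar>real i - real j\<bar>"
    have t: "t / \<kappa> - \<kappa> \<le> d (f i) (f j)" "d (f i) (f j) \<le> \<kappa> * t + \<kappa>" "0 \<le> t"
      using discrete_quasi_geodesicD[OF qg ij] by (auto simp: t_def)
    have vH: "v (f i) \<in> H" "v (f j) \<in> H" using v nr ij by auto
    note cl = close[OF car car nr nr, OF ij ij]
    define s where "s = dist (\<phi> (v (f i)) x) (\<phi> (v (f j)) x)"
    have "t / \<kappa> - \<kappa> - 2 * L1 \<le> A * (s + 1)"
      using orbit_coarse_inverse[OF vH] cl(1) t by (simp add: s_def)
    then have "(t / \<kappa> - \<kappa> - 2 * L1) / A \<le> s + 1" using A_ge_1 by (simp add: field_simps)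
    moreover have "(\<kappa> + 2 * L1) / A \<le> (\<kappa> + 2 * L1) / 1"
      using A_ge_1 \<kappa> L1 by (intro divide_left_mono) auto
    moreover have "t / \<kappa>' \<le> t / (A * \<kappa>)" using t(3) A\<kappa> A_ge_1 \<kappa> by (intro divide_left_mono) auto
    moreover have "(t / \<kappa> - \<kappa> - 2 * L1) / A = t / (A * \<kappa>) - (\<kappa> + 2 * L1) / A"
      by (simp add: diff_divide_distrib add_divide_distrib mult.commute)
    ultimately have "t / \<kappa>' - \<kappa>' \<le> s" using A\<kappa>(3) by simp
    then show "\<bar>real i - real j\<bar> / \<kappa>' - \<kappa>' \<le> dist (\<phi> (v (f i)) x) (\<phi> (v (f j)) x)"
      by (simp add: t_def s_def)
    have "s \<le> A * (\<kappa> * t + \<kappa> + 2 * L1)"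
      unfolding s_def using cl(2) t vH H_carrier by (intro orbit_step) auto
    also have "\<dots> = A * \<kappa> * t + A * (\<kappa> + 2 * L1)" by (simp add: algebra_simps)
    also have "\<dots> \<le> \<kappa>' * t + \<kappa>'" using A\<kappa> t(3) by (intro add_mono mult_right_mono) auto
    finally show "dist (\<phi> (v (f i)) x) (\<phi> (v (f j)) x) \<le> \<kappa>' * \<bar>real i - real j\<bar> + \<kappa>'"
      by (simp add: t_def s_def)
  qed
  have "\<exists>j\<le>m. d (f i) (g j) \<le> A * (M + 1) + 2 * L1"
    if qg: "discrete_quasi_geodesic d \<kappa> n f" "discrete_quasi_geodesic d \<kappa> m g"
      and car: "\<And>j. j \<le> n \<Longrightarrow> f j \<in> carrier G" "\<And>j. j \<le> m \<Longrightarrow> g j \<in> carrier G"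
      and eq: "f 0 = g 0" "f n = g m" and ends: "\<exists>h\<in>H. d (f 0) h \<le> 1" "\<exists>h\<in>H. d (f n) h \<le> 1"
      and i: "i \<le> n" for n m f g i
  proof -
    have nf: "\<And>i. i \<le> n \<Longrightarrow> \<exists>h\<in>H. d (f i) h \<le> L1" using near[OF qg(1) car(1) ends] .
    have ng: "\<And>i. i \<le> m \<Longrightarrow> \<exists>h\<in>H. d (g i) h \<le> L1" using near[OF qg(2) car(2)] ends eq by simp
    obtain j where j: "j \<le> m" "dist (\<phi> (v (f i)) x) (\<phi> (v (g j)) x) \<le> M"
      using M[rule_format, OF image[OF qg(1) car(1) nf] image[OF qg(2) car(2) ng] _ _ i] eq by auto
    have "d (v (f i)) (v (g j)) \<le> A * (dist (\<phi> (v (f i)) x) (\<phi> (v (g j)) x) + 1)"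
      using v nf ng i j by (intro orbit_coarse_inverse) auto
    also have "\<dots> \<le> A * (M + 1)" using j A_ge_1 by (intro mult_left_mono) auto
    finally show ?thesis using close(1)[OF car(1)[OF i] car(2)[OF j(1)] nf[OF i] ng[OF j(1)]] j(1)
      by (intro exI[of _ j]) auto
  qed
  then show ?thesis by (rule that)
qed

end

section \<open>The path metric of a Cayley graph\<close>

lemma pl_path_nonneg: "pl_path \<C> p q l \<Longrightarrow> 0 \<le> l"
  by (induction rule: pl_path.induct) (auto intro!: add_nonneg_nonneg sum_nonneg)

lemma pl_path_cell:
  assumes "e \<in> \<C>" "p \<in> closed_cell e" "q \<in> closed_cell e"
  shows "pl_path \<C> p q ((\<Sum>x\<in>e. \<bar>p x - q x\<bar>) / 2)"
proof -
  have "pl_path \<C> p p 0" using assms by (intro pl_path.refl) (auto simp: graph_points_def)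
  from pl_path.step[OF this assms] show ?thesis by simp
qed

lemma pl_path_trans:
  assumes "pl_path \<C> q r l'" "pl_path \<C> p q l"
  shows "pl_path \<C> p r (l + l')"
  using assms
proof (induction rule: pl_path.induct)
  case (step p' q' l' e r)
  then show ?case using pl_path.step[of \<C> p q' "l + l'" e r] by (simp add: add.assoc)
qed simp

lemma pl_path_sym: "pl_path \<C> p q l \<Longrightarrow> pl_path \<C> q p l"
proof (induction rule: pl_path.induct)
  case (step p q l e r)
  have "pl_path \<C> r q ((\<Sum>x\<in>e. \<bar>r x - q x\<bar>) / 2)" using step by (intro pl_path_cell)
  from pl_path_trans[OF step.IH this] show ?case by (simp add: abs_minus_commute add.commute)
qed (rule pl_path.refl)

lemma graph_dist_le:
  assumes "pl_path \<C> p q l"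
  shows "graph_dist \<C> p q \<le> l"
  unfolding graph_dist_def using assms pl_path_nonneg by (intro cInf_lower bdd_belowI) auto

lemma graph_dist_commute: "graph_dist \<C> p q = graph_dist \<C> q p"
proof -
  have "pl_path \<C> p q = pl_path \<C> q p" using pl_path_sym by blast
  then show ?thesis by (simp add: graph_dist_def)
qed

text \<open>The existence of paths is assumed because the infimum of an empty set of lengths carries
  no information.\<close>

lemma graph_dist_triangle:
  assumes "pl_path \<C> p q l" "pl_path \<C> q r l'"
  shows "graph_dist \<C> p r \<le> graph_dist \<C> p q + graph_dist \<C> q r"
proof -
  have "graph_dist \<C> p r - b \<le> graph_dist \<C> p q" if "pl_path \<C> q r b" for b
    unfolding graph_dist_def[of \<C> p q]
  proof (rule cInf_greatest)
    fix a assume "a \<in> {l. pl_path \<C> p q l}"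
    then show "graph_dist \<C> p r - b \<le> a" using graph_dist_le[OF pl_path_trans[OF that, of p a]] by simp
  qed (use assms in auto)
  then have "graph_dist \<C> p r - graph_dist \<C> p q \<le> b" if "pl_path \<C> q r b" for b using that by fastforce
  then have "graph_dist \<C> p r - graph_dist \<C> p q \<le> graph_dist \<C> q r"
    unfolding graph_dist_def[of \<C> q r] by (intro cInf_greatest) (use assms in auto)
  then show ?thesis by simp
qed

text \<open>
  Extending the 1-Lipschitz vertex function \<open>word_dist G S g\<close> linearly over the edges bounds the
  length of piecewise linear paths from below.
\<close>

definition linear_extension :: "('v \<Rightarrow> real) \<Rightarrow> ('v \<Rightarrow> real) \<Rightarrow> real" where
  "linear_extension F p = (\<Sum>v | p v \<noteq> 0. p v * F v)"

text \<open>Summation over the support depends on the point alone, so the values from different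
  cells agree where a path passes from one cell to the next.\<close>

lemma linear_extension_cell:
  assumes "finite e" "p \<in> closed_cell e"
  shows "linear_extension F p = (\<Sum>v\<in>e. p v * F v)"
  unfolding linear_extension_def using assms
  by (intro sum.mono_neutral_left) (auto simp: closed_cell_def)

lemma linear_extension_vertex_point: "linear_extension F (vertex_point v) = F v"
proof -
  have "{u. vertex_point v u \<noteq> 0} = {v}" by (auto simp: vertex_point_def)
  then show ?thesis by (simp add: linear_extension_def) (simp add: vertex_point_def)
qed

lemma linear_extension_lipschitz_cell:
  assumes q: "q \<in> closed_cell {u, v}" and r: "r \<in> closed_cell {u, v}" and F: "\<bar>F u - F v\<bar> \<le> 1"
  shows "\<bar>linear_extension F q - linear_extension F r\<bar> \<le> (\<Sum>x\<in>{u, v}. \<bar>q x - r x\<bar>) / 2"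
proof (cases "u = v")
  case True
  then show ?thesis using q r by (simp add: linear_extension_cell[of "{u, v}"]) (simp add: closed_cell_def)
next
  case False
  then have sums: "q v = 1 - q u" "r v = 1 - r u" using q r by (auto simp: closed_cell_def)
  have "linear_extension F q - linear_extension F r = (q u - r u) * (F u - F v)"
    using False by (simp add: linear_extension_cell[OF _ q] linear_extension_cell[OF _ r] sums algebra_simps)
  then have "\<bar>linear_extension F q - linear_extension F r\<bar> = \<bar>q u - r u\<bar> * \<bar>F u - F v\<bar>"
    by (simp add: abs_mult)
  also have "\<dots> \<le> \<bar>q u - r u\<bar> * 1" using F by (intro mult_left_mono) auto
  also have "\<dots> = (\<Sum>x\<in>{u, v}. \<bar>q x - r x\<bar>) / 2" using False by (simp add: sums abs_minus_commute)
  finally show ?thesis .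
qed

lemma linear_extension_lipschitz:
  assumes "pl_path \<C> p q l"
    and edges: "\<And>e. e \<in> \<C> \<Longrightarrow> \<exists>u v. e = {u, v} \<and> \<bar>F u - F v\<bar> \<le> (1::real)"
  shows "\<bar>linear_extension F p - linear_extension F q\<bar> \<le> l"
  using assms(1)
proof (induction rule: pl_path.induct)
  case (step p q l e r)
  obtain u v where "e = {u, v}" "\<bar>F u - F v\<bar> \<le> 1" using edges step by blast
  then have "\<bar>linear_extension F q - linear_extension F r\<bar> \<le> (\<Sum>x\<in>e. \<bar>q x - r x\<bar>) / 2"
    using step linear_extension_lipschitz_cell[of q u v r F] by simp
  then show ?case using step.IH by linarith
qed simp

lemma vertex_point_mem_closed_cell:
  assumes "finite e" "v \<in> e"
  shows "vertex_point v \<in> closed_cell e"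
  using assms by (auto simp: closed_cell_def vertex_point_def)

section \<open>Comparison of the Cayley graph with the word metric\<close>

context group
begin

context
  fixes S
  assumes S: "S \<subseteq> carrier G" "generate G S = carrier G"
begin

lemma cayley_cells_cases:
  assumes "e \<in> cayley_cells G S"
  obtains u v where "e = {u, v}" "u \<in> carrier G" "v \<in> carrier G" "word_dist G S u v \<le> 1"
  using assms unfolding cayley_cells_def
proof (elim UnE CollectE exE conjE)
  fix g assume "e = {g}" "g \<in> carrier G"
  then show ?thesis using that[of g g] by (simp add: word_dist_self)
next
  fix g s assume g: "e = {g, g \<otimes> s}" "g \<in> carrier G" "s \<in> S"
  then have "s \<in> carrier G" using S by auto
  then have "word_dist G S g (g \<otimes> s) = real (word_length G S s)"
    using g by (simp add: word_dist_def inv_mult_cancel)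
  also have "\<dots> \<le> 1" using word_length_le[of "[s]" S s] g \<open>s \<in> carrier G\<close> by simp
  finally show ?thesis using that[of g "g \<otimes> s"] g \<open>s \<in> carrier G\<close> by simp
qed

text \<open>The length is bounded by \<open>1\<close> rather than equal to it, since the letter
  \<open>s\<close> may be the identity.\<close>

lemma pl_path_letter:
  assumes g: "g \<in> carrier G" and s: "s \<in> S \<union> m_inv G ` S"
  shows "\<exists>l\<le>1. pl_path (cayley_cells G S) (vertex_point g) (vertex_point (g \<otimes> s)) l"
proof -
  have le: "\<exists>l\<le>1. pl_path (cayley_cells G S) (vertex_point u) (vertex_point v) l"
    if "{u, v} \<in> cayley_cells G S" for u v
  proof (intro exI conjI)
    show "pl_path (cayley_cells G S) (vertex_point u) (vertex_point v)
        ((\<Sum>x\<in>{u, v}. \<bar>vertex_point u x - vertex_point v x\<bar>) / 2)"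
      using that by (intro pl_path_cell vertex_point_mem_closed_cell) auto
    show "(\<Sum>x\<in>{u, v}. \<bar>vertex_point u x - vertex_point v x\<bar>) / 2 \<le> 1"
      by (cases "u = v") (auto simp: vertex_point_def)
  qed
  from s show ?thesis
  proof
    assume "s \<in> S"
    then show ?thesis using g by (intro le) (auto simp: cayley_cells_def)
  next
    assume "s \<in> m_inv G ` S"
    then obtain t where t: "t \<in> S" "s = inv t" by blast
    then have "t \<in> carrier G" using S by auto
    \<comment> \<open>Edges are given by right multiplication with elements of \<open>S\<close>; for
      an inverse letter the edge is read from its other end.\<close>
    then have "{g, g \<otimes> s} = {g \<otimes> s, (g \<otimes> s) \<otimes> t}" "g \<otimes> s \<in> carrier G"
      using g t by (auto simp: m_assoc)
    then have "{g, g \<otimes> s} \<in> cayley_cells G S" using t unfolding cayley_cells_def by blast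
    then show ?thesis by (rule le)
  qed
qed

lemma pl_path_vertices:
  assumes gh: "g \<in> carrier G" "h \<in> carrier G"
  shows "\<exists>l\<le>word_dist G S g h. pl_path (cayley_cells G S) (vertex_point g) (vertex_point h) l"
proof -
  obtain f where f: "f 0 = g" "f (word_length G S (inv g \<otimes> h)) = h" "\<And>i. f i \<in> generate G S"
    "\<And>i. i < word_length G S (inv g \<otimes> h) \<Longrightarrow> \<exists>s\<in>S \<union> m_inv G ` S. f (Suc i) = f i \<otimes> s"
    using geodesic_word_path[OF S(1), of g h] gh S(2) by metis
  have "\<exists>l\<le>real i. pl_path (cayley_cells G S) (vertex_point g) (vertex_point (f i)) l"
    if "i \<le> word_length G S (inv g \<otimes> h)" for i
    using that
  proof (induction i)
    case 0
    have "vertex_point g \<in> graph_points (cayley_cells G S)"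
      using gh vertex_point_mem_closed_cell[of "{g}" g] by (auto simp: graph_points_def cayley_cells_def)
    then show ?case using pl_path.refl f(1) by auto
  next
    case (Suc i)
    then obtain l where l: "l \<le> real i" "pl_path (cayley_cells G S) (vertex_point g) (vertex_point (f i)) l"
      by auto
    obtain s where s: "s \<in> S \<union> m_inv G ` S" "f (Suc i) = f i \<otimes> s" using f(4)[of i] Suc.prems by auto
    obtain l' where "l' \<le> 1" "pl_path (cayley_cells G S) (vertex_point (f i)) (vertex_point (f (Suc i))) l'"
      using pl_path_letter[OF _ s(1), of "f i"] f(3)[of i] s(2) S(2) by auto
    then show ?case using l pl_path_trans[of "cayley_cells G S" "vertex_point (f i)"]
      by (intro exI[of _ "l + l'"]) auto
  qed
  from this[of "word_length G S (inv g \<otimes> h)"] show ?thesis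
    using f(2) unfolding word_dist_def by simp
qed

lemma cayley_dist_vertices:
  assumes gh: "g \<in> carrier G" "h \<in> carrier G"
  shows "cayley_dist G S (vertex_point g) (vertex_point h) = word_dist G S g h"
proof (rule antisym)
  obtain l where l: "l \<le> word_dist G S g h" "pl_path (cayley_cells G S) (vertex_point g) (vertex_point h) l"
    using pl_path_vertices[OF gh] by blast
  then show "cayley_dist G S (vertex_point g) (vertex_point h) \<le> word_dist G S g h"
    using graph_dist_le unfolding cayley_dist_def by fastforce
  show "word_dist G S g h \<le> cayley_dist G S (vertex_point g) (vertex_point h)"
    unfolding cayley_dist_def graph_dist_def
  proof (rule cInf_greatest)
    fix a assume a: "a \<in> {l. pl_path (cayley_cells G S) (vertex_point g) (vertex_point h) l}"
    define F where "F = word_dist G S g"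
    have "\<bar>linear_extension F (vertex_point g) - linear_extension F (vertex_point h)\<bar> \<le> a"
    proof (rule linear_extension_lipschitz)
      fix e assume "e \<in> cayley_cells G S"
      then obtain u v where uv: "e = {u, v}" "u \<in> carrier G" "v \<in> carrier G" "word_dist G S u v \<le> 1"
        by (rule cayley_cells_cases)
      have "\<bar>F u - F v\<bar> \<le> 1"
        using uv word_dist_triangle[OF S(1), of g u v] word_dist_triangle[OF S(1), of g v u]
          word_dist_commute[OF S(1), of u v] gh S(2) by (auto simp: F_def)
      then show "\<exists>u v. e = {u, v} \<and> \<bar>F u - F v\<bar> \<le> 1" using uv(1) by blast
    qed (use a in auto)
    then show "word_dist G S g h \<le> a"
      using gh by (simp add: linear_extension_vertex_point F_def word_dist_self)
  qed (use l in auto)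
qed

lemma pl_path_to_vertex:
  assumes "p \<in> cayley_points G S"
  shows "\<exists>g\<in>carrier G. \<exists>l\<le>1. pl_path (cayley_cells G S) p (vertex_point g) l"
proof -
  obtain e where e: "e \<in> cayley_cells G S" "p \<in> closed_cell e"
    using assms by (auto simp: cayley_points_def graph_points_def)
  from e(1) obtain u v where uv: "e = {u, v}" "u \<in> carrier G" by (rule cayley_cells_cases)
  have u: "vertex_point u \<in> closed_cell e" using uv by (intro vertex_point_mem_closed_cell) auto
  \<comment> \<open>Barycentric coordinates are nonnegative with sum \<open>1\<close>, so any two
    points of a cell have coordinate difference at most \<open>2\<close>, that is, distance at most
    \<open>1\<close>.\<close>
  have "(\<Sum>x\<in>e. \<bar>p x - vertex_point u x\<bar>) \<le> (\<Sum>x\<in>e. p x + vertex_point u x)"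
    using e(2) u by (intro sum_mono) (auto simp: closed_cell_def abs_le_iff)
  also have "\<dots> = 2" using e(2) u by (simp add: closed_cell_def sum.distrib)
  finally have "(\<Sum>x\<in>e. \<bar>p x - vertex_point u x\<bar>) / 2 \<le> 1" by simp
  then show ?thesis using pl_path_cell[OF e u] uv(2) by blast
qed

lemma pl_path_connected:
  assumes "p \<in> cayley_points G S" "q \<in> cayley_points G S"
  shows "\<exists>l. pl_path (cayley_cells G S) p q l"
proof -
  obtain g a h b where "g \<in> carrier G" "h \<in> carrier G" "pl_path (cayley_cells G S) p (vertex_point g) a"
    "pl_path (cayley_cells G S) q (vertex_point h) b"
    using pl_path_to_vertex assms by meson
  then show ?thesis using pl_path_vertices[of g h] by (meson pl_path_sym pl_path_trans)
qed

lemma cayley_dist_triangle: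
  assumes "p \<in> cayley_points G S" "q \<in> cayley_points G S" "r \<in> cayley_points G S"
  shows "cayley_dist G S p r \<le> cayley_dist G S p q + cayley_dist G S q r"
  using pl_path_connected[OF assms(1,2)] pl_path_connected[OF assms(2,3)] graph_dist_triangle
  unfolding cayley_dist_def by blast

lemma cayley_dist_commute: "cayley_dist G S p q = cayley_dist G S q p"
  unfolding cayley_dist_def by (rule graph_dist_commute)

lemma near_vertex:
  assumes "p \<in> cayley_points G S"
  shows "\<exists>g\<in>carrier G. cayley_dist G S p (vertex_point g) \<le> 1"
  using pl_path_to_vertex[OF assms] graph_dist_le unfolding cayley_dist_def by (meson order_trans)

lemma vertex_point_mem_cayley_points: "g \<in> carrier G \<Longrightarrow> vertex_point g \<in> cayley_points G S"
  using vertex_point_mem_closed_cell[of "{g}" g]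
  by (auto simp: cayley_points_def graph_points_def cayley_cells_def)

end

end

text \<open>Samples at integer times, the last one clipped to \<open>b\<close> so that the endpoint
  is kept. Clipping changes time differences by at most \<open>1\<close> and rounding to vertices
  changes distances by at most \<open>2\<close>; together this gives
  \<open>\<tau> + 3\<close>.\<close>

lemma (in group) discretize_quasi_geodesic:
  assumes S: "S \<subseteq> carrier G" "generate G S = carrier G" and \<tau>: "1 \<le> \<tau>" and "a \<le> b"
    and \<gamma>: "quasi_geodesic (cayley_points G S) (cayley_dist G S) \<tau> {a..b} \<gamma>"
    and v: "\<And>p. p \<in> cayley_points G S \<Longrightarrow> v p \<in> carrier G \<and> cayley_dist G S p (vertex_point (v p)) \<le> 1"
  shows "discrete_quasi_geodesic (word_dist G S) (\<tau> + 3) (nat \<lceil>b - a\<rceil>) (\<lambda>i. v (\<gamma> (min (a + real i) b)))"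
  unfolding discrete_quasi_geodesic_def
proof (intro allI impI)
  fix i j assume ij: "i \<le> nat \<lceil>b - a\<rceil>" "j \<le> nat \<lceil>b - a\<rceil>"
  have n: "real (nat \<lceil>b - a\<rceil>) \<le> b - a + 1" using \<open>a \<le> b\<close> by linarith
  have ij': "real i \<le> b - a + 1" "real j \<le> b - a + 1"
    using n of_nat_mono[OF ij(1), where 'a = real] of_nat_mono[OF ij(2), where 'a = real] by linarith+
  define s where "s = min (a + real i) b"
  define t where "t = min (a + real j) b"
  have st: "s \<in> {a..b}" "t \<in> {a..b}" using \<open>a \<le> b\<close> by (auto simp: s_def t_def)
  define p where "p = \<gamma> s"
  define q where "q = \<gamma> t"
  have pq: "p \<in> cayley_points G S" "q \<in> cayley_points G S"
    using \<gamma> st by (auto simp: p_def q_def quasi_geodesic_def)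
  have vp: "vertex_point (v p) \<in> cayley_points G S" "vertex_point (v q) \<in> cayley_points G S"
    using v pq vertex_point_mem_cayley_points[OF S] by auto
  have wd: "word_dist G S (v p) (v q) = cayley_dist G S (vertex_point (v p)) (vertex_point (v q))"
    using v pq cayley_dist_vertices[OF S] by auto
  note tri = cayley_dist_triangle[OF S]
  note com = cayley_dist_commute[OF S]
  have close: "cayley_dist G S p q \<le> word_dist G S (v p) (v q) + 2"
    "word_dist G S (v p) (v q) \<le> cayley_dist G S p q + 2"
    using tri[OF pq(1) vp(1) pq(2)] tri[OF vp(1) vp(2) pq(2)] tri[OF vp(1) pq(1) vp(2)]
      tri[OF pq(1) pq(2) vp(2)] v[OF pq(1)] v[OF pq(2)] com[of q "vertex_point (v q)"]
      com[of p "vertex_point (v p)"] unfolding wd by linarith+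
  have qg: "\<bar>s - t\<bar> / \<tau> - \<tau> \<le> cayley_dist G S p q" "cayley_dist G S p q \<le> \<tau> * \<bar>s - t\<bar> + \<tau>"
    using \<gamma> st unfolding quasi_geodesic_def p_def q_def by auto
  define w where "w = \<bar>real i - real j\<bar>"
  have w: "0 \<le> w" "\<bar>s - t\<bar> \<le> w" "w - 1 \<le> \<bar>s - t\<bar>"
    using ij' by (auto simp: s_def t_def w_def min_def abs_if)
  have "w / (\<tau> + 3) \<le> w / \<tau>" using w \<tau> by (intro divide_left_mono) auto
  also have "\<dots> = (w - 1) / \<tau> + 1 / \<tau>" by (simp add: diff_divide_distrib)
  also have "\<dots> \<le> \<bar>s - t\<bar> / \<tau> + 1" using w \<tau> by (intro add_mono divide_right_mono) auto
  finally have lower: "w / (\<tau> + 3) - (\<tau> + 3) \<le> word_dist G S (v p) (v q)" using close qg by linarith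
  have "\<tau> * \<bar>s - t\<bar> \<le> (\<tau> + 3) * w" using w \<tau> by (intro mult_mono) auto
  then have "word_dist G S (v p) (v q) \<le> (\<tau> + 3) * w + (\<tau> + 3)" using close qg by linarith
  with lower show "\<bar>real i - real j\<bar> / (\<tau> + 3) - (\<tau> + 3)
      \<le> word_dist G S (v (\<gamma> (min (a + real i) b))) (v (\<gamma> (min (a + real j) b))) \<and>
    word_dist G S (v (\<gamma> (min (a + real i) b))) (v (\<gamma> (min (a + real j) b)))
      \<le> (\<tau> + 3) * \<bar>real i - real j\<bar> + (\<tau> + 3)"
    by (simp add: w_def p_def q_def s_def t_def)
qed

section \<open>Stability\<close>

text \<open>Acylindricity and the quasi-isometric embedding may come with different base points
  \<open>x\<close> and \<open>x'\<close>. Since the action is isometric, moving the embedding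
  estimate to \<open>x\<close> costs \<open>2 * dist x x'\<close>. The generating set
  \<open>T\<close> is returned for the proof that \<open>H\<close> is undistorted.\<close>

lemma AQI_orbit:
  fixes G :: "('g, 'm) monoid_scheme" and \<phi> :: "'g \<Rightarrow> 'x::metric_space \<Rightarrow> 'x"
  assumes AQI: "AQI_triple G \<phi> H" and S: "finite_generating_set G (carrier G) S"
  obtains T x A \<delta> where "finite_generating_set G H T" "quasi_isometric_orbit G \<phi> H S x A \<delta>"
    "\<And>g h. g \<in> H \<Longrightarrow> h \<in> H \<Longrightarrow> word_dist G T g h \<le> A * (dist (\<phi> g x) (\<phi> h x) + 1)"
proof -
  have act: "group_action G UNIV \<phi>"
    and iso: "\<And>g y z. g \<in> carrier G \<Longrightarrow> dist (\<phi> g y) (\<phi> g z) = dist y z"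
    using AQI by (auto simp: AQI_triple_def isometric_action_def)
  have "group G" using group_action.group_hom[OF act] by (simp add: group_hom_def)
  interpret group G by fact
  have act_mult: "\<And>g h y. g \<in> carrier G \<Longrightarrow> h \<in> carrier G \<Longrightarrow> \<phi> (g \<otimes>\<^bsub>G\<^esub> h) y = \<phi> g (\<phi> h y)"
    using group_action.composition_rule[OF act] by simp
  have act_one: "\<phi> \<one>\<^bsub>G\<^esub> y = y" for y
    using group_action.id_eq_one[OF act] by (metis UNIV_I restrict_apply')
  have H: "subgroup H G" and geo: "geodesic_space TYPE('x)"
    using AQI by (auto simp: AQI_triple_def hyperbolic_space_def)
  obtain \<delta> where \<delta>: "0 \<le> \<delta>" "four_point_hyperbolic \<delta> TYPE('x)"
    using AQI by (auto simp: AQI_triple_def hyperbolic_space_def gromov_hyperbolic_def four_point_hyperbolic_def)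
  obtain x where acyl: "acylindrical_along_set G \<phi> ((\<lambda>h. \<phi> h x) ` H)"
    using AQI by (auto simp: AQI_triple_def acylindrical_along_subgroup_def)
  obtain T x' where T: "finite_generating_set G H T" and
    qi: "qi_embedding H (word_dist G T) dist (\<lambda>h. \<phi> h x')"
    using AQI by (auto simp: AQI_triple_def qi_embedded_by_action_def)
  obtain K C where K: "1 \<le> K" "0 \<le> C" and KC: "\<And>g h. g \<in> H \<Longrightarrow> h \<in> H \<Longrightarrow>
      word_dist G T g h / K - C \<le> dist (\<phi> g x') (\<phi> h x')"
    using qi unfolding qi_embedding_def by blast
  have S': "finite S" "S \<subseteq> carrier G" "generate G S = carrier G"
    and T': "finite T" "T \<subseteq> carrier G" "generate G T = H"
    using S T by (auto simp: finite_generating_set_def)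
  have Hc: "h \<in> carrier G" if "h \<in> H" for h using subgroup.mem_carrier[OF H that] .
  \<comment> \<open>The displacement of \<open>x\<close> is subadditive and the distance of two
    orbit points is the displacement of their quotient, so bounds on letters give Lipschitz
    bounds.\<close>
  define N where "N g = dist (\<phi> g x) x" for g
  have N_mult: "N (g \<otimes>\<^bsub>G\<^esub> h) \<le> N g + N h" if "g \<in> carrier G" "h \<in> carrier G" for g h
    using that iso[of g "\<phi> h x" x] dist_triangle[of "\<phi> g (\<phi> h x)" x "\<phi> g x"]
    by (simp add: N_def act_mult)
  have N_dist: "dist (\<phi> g x) (\<phi> h x) = N (inv\<^bsub>G\<^esub> g \<otimes>\<^bsub>G\<^esub> h)" if "g \<in> carrier G" "h \<in> carrier G" for g h
    using that iso[of "inv\<^bsub>G\<^esub> g" "\<phi> g x" "\<phi> h x"] act_mult[of "inv\<^bsub>G\<^esub> g" g] act_one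
    by (simp add: N_def act_mult dist_commute)
  obtain K1 where K1: "1 \<le> K1" "\<And>s. s \<in> S \<union> m_inv G ` S \<Longrightarrow> N s \<le> K1"
    by (rule bounded_on_letters[OF S'(1), of N]) (rule that)
  obtain K2 where K2: "1 \<le> K2" "\<And>s. s \<in> T \<union> m_inv G ` T \<Longrightarrow> N s \<le> K2"
    by (rule bounded_on_letters[OF T'(1), of N]) (rule that)
  have T_in_S: "generate G T \<subseteq> generate G S" unfolding S' T' using Hc by blast
  obtain K3 where K3: "1 \<le> K3"
    "\<And>g h. g \<in> H \<Longrightarrow> h \<in> H \<Longrightarrow> word_dist G S g h \<le> K3 * word_dist G T g h"
    by (rule word_dist_comparison[OF T'(1,2) S'(2) T_in_S, unfolded T'(3)]) (rule that)
  define e where "e = dist x x'"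
  define A0 where "A0 = K * (2 * e + C + 1)"
  \<comment> \<open>\<open>K1\<close> bounds the displacement of letters of \<open>S\<close>,
    \<open>K2\<close> that of letters of \<open>T\<close> and so the steps of chains, and
    \<open>K3 * A0\<close> recovers distance in \<open>G\<close> through the word metric of
    \<open>T\<close>.\<close>
  define A where "A = K1 + K2 + K3 * A0"
  have A0: "1 \<le> A0"
    using K mult_mono[of 1 K 1 "2 * e + C + 1"] by (simp add: A0_def e_def)
  have "1 * A0 \<le> K3 * A0" using K3 A0 by (intro mult_right_mono) auto
  then have A: "1 \<le> A" "K1 \<le> A" "K2 \<le> A" "A0 \<le> A" "K3 * A0 \<le> A"
    using A0 K1(1) K2(1) K3(1) unfolding A_def by linarith+
  have T_le: "word_dist G T g h \<le> A0 * (dist (\<phi> g x) (\<phi> h x) + 1)" if gh: "g \<in> H" "h \<in> H" for g h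
  proof -
    have "dist (\<phi> g x') (\<phi> h x') \<le> dist (\<phi> g x) (\<phi> h x) + 2 * e"
      using iso[OF Hc[OF gh(1)], of x x'] iso[OF Hc[OF gh(2)], of x x']
        dist_triangle[of "\<phi> g x'" "\<phi> h x'" "\<phi> g x"] dist_triangle[of "\<phi> g x" "\<phi> h x'" "\<phi> h x"]
      by (simp add: e_def dist_commute)
    then have "word_dist G T g h / K \<le> dist (\<phi> g x) (\<phi> h x) + (2 * e + C)" using KC[OF gh] by linarith
    also have "\<dots> \<le> (2 * e + C + 1) * (dist (\<phi> g x) (\<phi> h x) + 1)"
      using K by (simp add: algebra_simps e_def)
    finally show ?thesis using K by (simp add: A0_def pos_divide_le_eq mult_ac)
  qed
  have T_le_A: "word_dist G T g h \<le> A * (dist (\<phi> g x) (\<phi> h x) + 1)" if "g \<in> H" "h \<in> H" for g h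
    using A by (intro order_trans[OF T_le[OF that]] mult_right_mono) auto
  have "quasi_isometric_orbit G \<phi> H S x A \<delta>"
  proof (intro quasi_isometric_orbit.intro quasi_isometric_orbit_axioms.intro)
    show "dist (\<phi> g x) (\<phi> h x) \<le> A * word_dist G S g h" if gh: "g \<in> carrier G" "h \<in> carrier G" for g h
    proof -
      have "N (inv\<^bsub>G\<^esub> g \<otimes>\<^bsub>G\<^esub> h) \<le> A * word_length G S (inv\<^bsub>G\<^esub> g \<otimes>\<^bsub>G\<^esub> h)"
      proof (rule subadditive_le_word_length[OF S'(2)])
        show "N s \<le> A" if "s \<in> S \<union> m_inv G ` S" for s using K1(2)[OF that] A(2) by simp
      qed (use gh S'(3) N_mult act_one in \<open>auto simp: N_def\<close>)
      then show ?thesis by (simp add: N_dist[OF gh] word_dist_def)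
    qed
    show "word_dist G S g h \<le> A * (dist (\<phi> g x) (\<phi> h x) + 1)" if gh: "g \<in> H" "h \<in> H" for g h
    proof -
      have "word_dist G S g h \<le> K3 * (A0 * (dist (\<phi> g x) (\<phi> h x) + 1))"
        using T_le[OF gh] K3(1) by (intro order_trans[OF K3(2)[OF gh]] mult_left_mono) auto
      also have "\<dots> = (K3 * A0) * (dist (\<phi> g x) (\<phi> h x) + 1)" by simp
      also have "\<dots> \<le> A * (dist (\<phi> g x) (\<phi> h x) + 1)" using A(5) by (intro mult_right_mono) auto
      finally show ?thesis .
    qed
    show "linearly_chained A A ((\<lambda>h. \<phi> h x) ` H)"
      unfolding linearly_chained_def
    proof (intro ballI)
      fix p q assume "p \<in> (\<lambda>h. \<phi> h x) ` H" "q \<in> (\<lambda>h. \<phi> h x) ` H"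
      then obtain g h where gh: "g \<in> H" "h \<in> H" "p = \<phi> g x" "q = \<phi> h x" by blast
      define n where "n = word_length G T (inv\<^bsub>G\<^esub> g \<otimes>\<^bsub>G\<^esub> h)"
      obtain f where f: "f 0 = g" "f n = h" "\<And>i. f i \<in> H"
        "\<And>i. i < n \<Longrightarrow> \<exists>s\<in>T \<union> m_inv G ` T. f (Suc i) = f i \<otimes>\<^bsub>G\<^esub> s"
        using geodesic_word_path[OF T'(2), of g h] gh T'(3) unfolding n_def by metis
      have "dist (\<phi> (f i) x) (\<phi> (f (Suc i)) x) \<le> A" if i: "i < n" for i
      proof -
        obtain s where s: "s \<in> T \<union> m_inv G ` T" "f (Suc i) = f i \<otimes>\<^bsub>G\<^esub> s" using f(4)[OF i] by blast
        then have "s \<in> carrier G" using letters_subset_carrier[OF T'(2)] by blast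
        then have "dist (\<phi> (f i) x) (\<phi> (f (Suc i)) x) = N s"
          using N_dist[of "f i" "f (Suc i)"] f(3) Hc s(2) by (simp add: inv_mult_cancel)
        then show ?thesis using K2(2)[OF s(1)] A(3) by simp
      qed
      moreover have "real n \<le> A * (dist p q + 1)"
        using T_le_A[OF gh(1,2)] by (simp add: gh(3,4) n_def word_dist_def)
      ultimately show "\<exists>n f. f 0 = p \<and> f n = q \<and> (\<forall>i\<le>n. f i \<in> (\<lambda>h. \<phi> h x) ` H) \<and>
          (\<forall>i<n. dist (f i) (f (Suc i)) \<le> A) \<and> real n \<le> A * (dist p q + 1)"
        using f gh by (intro exI[of _ n] exI[of _ "\<lambda>i. \<phi> (f i) x"]) auto
    qed
  qed (use \<open>group G\<close> H S' act_mult act_one iso geo \<delta> acyl A(1) in auto)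
  then show ?thesis using T T_le_A by (intro that)
qed

text \<open>Distance in \<open>H\<close> is recovered from the orbit in \<open>X\<close>, and
  distance in the orbit is at most linear in distance in \<open>G\<close>. Word metrics for
  \<open>T\<close> and for an arbitrary \<open>U\<close> differ by a factor.\<close>

lemma AQI_undistorted:
  fixes G :: "('g, 'm) monoid_scheme" and \<phi> :: "'g \<Rightarrow> 'x::metric_space \<Rightarrow> 'x"
  assumes AQI: "AQI_triple G \<phi> H"
  shows "undistorted G H"
  unfolding undistorted_def
proof (intro allI impI)
  fix S U assume S: "finite_generating_set G (carrier G) S" and U: "finite_generating_set G H U"
  obtain T x A \<delta> where T: "finite_generating_set G H T" and orb: "quasi_isometric_orbit G \<phi> H S x A \<delta>"
    and T_le: "\<And>g h. g \<in> H \<Longrightarrow> h \<in> H \<Longrightarrow> word_dist G T g h \<le> A * (dist (\<phi> g x) (\<phi> h x) + 1)"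
    by (rule AQI_orbit[OF AQI S]) (rule that)
  interpret quasi_isometric_orbit G \<phi> H S x A \<delta> by fact
  have T': "finite T" "T \<subseteq> carrier G" "generate G T = H"
    and U': "finite U" "U \<subseteq> carrier G" "generate G U = H"
    using T U by (auto simp: finite_generating_set_def)
  obtain K1 where K1: "1 \<le> K1"
    "\<And>g h. g \<in> H \<Longrightarrow> h \<in> H \<Longrightarrow> word_dist G U g h \<le> K1 * word_dist G T g h"
    by (rule word_dist_comparison[OF T'(1,2) U'(2), unfolded T'(3) U'(3)]) (simp, rule that)
  have "generate G U \<subseteq> generate G S" unfolding U' generate_S using H_carrier by blast
  from word_dist_comparison[OF U'(1,2) S_carrier this, unfolded U'(3)]
  obtain K2 where K2: "1 \<le> K2"
    "\<And>g h. g \<in> H \<Longrightarrow> h \<in> H \<Longrightarrow> word_dist G S g h \<le> K2 * word_dist G U g h" by metis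
  define K where "K = K1 * A * A + K2"
  have K1A: "0 \<le> K1 * A * A" using K1(1) A_ge_1 by simp
  have K_ge_1: "1 \<le> K" using K1A K2(1) by (simp add: K_def)
  show "qi_embedding H (word_dist G U) (word_dist G S) (\<lambda>h. h)"
    unfolding qi_embedding_def
  proof (intro exI[of _ K] conjI ballI)
    show "1 \<le> K" by (rule K_ge_1)
    fix g h assume gh: "g \<in> H" "h \<in> H"
    have d0: "0 \<le> d g h" "0 \<le> word_dist G U g h" by (auto simp: word_dist_def)
    have "K2 * word_dist G U g h \<le> K * word_dist G U g h"
      using d0 K1A by (intro mult_right_mono) (auto simp: K_def)
    then show "d g h \<le> K * word_dist G U g h + K" using K2(2)[OF gh] K_ge_1 by linarith
    have "word_dist G U g h \<le> K1 * (A * (A * d g h + 1))"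
    proof -
      have "dist (\<phi> g x) (\<phi> h x) + 1 \<le> A * d g h + 1"
        using orbit_lipschitz[of g h] gh H_carrier by simp
      then have "A * (dist (\<phi> g x) (\<phi> h x) + 1) \<le> A * (A * d g h + 1)"
        using A_ge_1 by (intro mult_left_mono) auto
      then have "word_dist G T g h \<le> A * (A * d g h + 1)" using T_le[OF gh] by linarith
      then show ?thesis using K1 gh by (intro order_trans[OF K1(2)[OF gh]] mult_left_mono) auto
    qed
    also have "\<dots> \<le> K1 * (A * (A * d g h + A))"
      using A_ge_1 K1(1) by (intro mult_left_mono add_left_mono) auto
    also have "\<dots> = (K1 * A * A) * (d g h + 1)" by (simp add: algebra_simps)
    also have "\<dots> \<le> K * (d g h + 1)" using K2(1) d0 by (intro mult_right_mono) (auto simp: K_def)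
    finally have "word_dist G U g h / K \<le> d g h + 1" using K_ge_1 by (simp add: pos_divide_le_eq mult.commute)
    then show "word_dist G U g h / K - K \<le> d g h" using K_ge_1 by simp
  qed (use K_ge_1 in simp)
qed

lemma (in quasi_isometric_orbit) quasi_geodesics_close:
  assumes \<tau>: "1 \<le> \<tau>"
  obtains L where "0 \<le> L" "\<And>\<gamma> \<gamma>' a b a' b' s. a \<le> b \<Longrightarrow> a' \<le> b' \<Longrightarrow>
      quasi_geodesic (cayley_points G S) (cayley_dist G S) \<tau> {a..b} \<gamma> \<Longrightarrow>
      quasi_geodesic (cayley_points G S) (cayley_dist G S) \<tau> {a'..b'} \<gamma>' \<Longrightarrow>
      \<gamma> a = \<gamma>' a' \<Longrightarrow> \<gamma> b = \<gamma>' b' \<Longrightarrow> \<gamma> a \<in> vertex_point ` H \<Longrightarrow> \<gamma> b \<in> vertex_point ` H \<Longrightarrow>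
      s \<in> {a..b} \<Longrightarrow> \<exists>t\<in>{a'..b'}. cayley_dist G S (\<gamma> s) (\<gamma>' t) \<le> L"
proof -
  note S = S_carrier generate_S
  have "1 \<le> \<tau> + 3" using \<tau> by simp
  then obtain L where L: "\<And>n m f g i. discrete_quasi_geodesic d (\<tau> + 3) n f \<Longrightarrow>
      discrete_quasi_geodesic d (\<tau> + 3) m g \<Longrightarrow>
      (\<And>j. j \<le> n \<Longrightarrow> f j \<in> carrier G) \<Longrightarrow> (\<And>j. j \<le> m \<Longrightarrow> g j \<in> carrier G) \<Longrightarrow>
      f 0 = g 0 \<Longrightarrow> f n = g m \<Longrightarrow> \<exists>h\<in>H. d (f 0) h \<le> 1 \<Longrightarrow> \<exists>h\<in>H. d (f n) h \<le> 1 \<Longrightarrow>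
      i \<le> n \<Longrightarrow> \<exists>j\<le>m. d (f i) (g j) \<le> L"
    by (rule discrete_stability) (rule that, blast)
  define v where "v p = (SOME g. g \<in> carrier G \<and> cayley_dist G S p (vertex_point g) \<le> 1)" for p
  have v: "v p \<in> carrier G \<and> cayley_dist G S p (vertex_point (v p)) \<le> 1" if "p \<in> cayley_points G S" for p
    unfolding v_def by (rule someI_ex) (use near_vertex[OF S that] in blast)
  \<comment> \<open>The bound adds \<open>2 * \<tau>\<close> for moving to an integer sample time,
    \<open>1\<close> for each of two roundings to a vertex, and the constant for sequences; the
    absolute value makes the sum nonnegative.\<close>
  have "\<exists>t\<in>{a'..b'}. cayley_dist G S (\<gamma> s) (\<gamma>' t) \<le> 2 * \<tau> + 2 + \<bar>L\<bar>"
    if ab: "a \<le> b" "a' \<le> b'"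
      and \<gamma>: "quasi_geodesic (cayley_points G S) (cayley_dist G S) \<tau> {a..b} \<gamma>"
      and \<gamma>': "quasi_geodesic (cayley_points G S) (cayley_dist G S) \<tau> {a'..b'} \<gamma>'"
      and eq: "\<gamma> a = \<gamma>' a'" "\<gamma> b = \<gamma>' b'" and ends: "\<gamma> a \<in> vertex_point ` H" "\<gamma> b \<in> vertex_point ` H"
      and s: "s \<in> {a..b}" for \<gamma> \<gamma>' a b a' b' s
  proof -
    have pts: "\<And>t. t \<in> {a..b} \<Longrightarrow> \<gamma> t \<in> cayley_points G S" "\<And>t. t \<in> {a'..b'} \<Longrightarrow> \<gamma>' t \<in> cayley_points G S"
      using \<gamma> \<gamma>' by (auto simp: quasi_geodesic_def)
    define n where "n = nat \<lceil>b - a\<rceil>"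
    define m where "m = nat \<lceil>b' - a'\<rceil>"
    have nm: "b \<le> a + real n" "b' \<le> a' + real m" unfolding n_def m_def by linarith+
    define f where "f i = v (\<gamma> (min (a + real i) b))" for i
    define g where "g i = v (\<gamma>' (min (a' + real i) b'))" for i
    have near_end: "\<exists>h\<in>H. d (v p) h \<le> 1" if p: "p \<in> vertex_point ` H" for p
    proof -
      obtain h where h: "h \<in> H" "p = vertex_point h" using p by blast
      then have "p \<in> cayley_points G S" using vertex_point_mem_cayley_points[OF S] H_carrier by simp
      then have "d (v p) h \<le> 1"
        using v[of p] h H_carrier cayley_dist_vertices[OF S, of h "v p"] d_commute[of h "v p"] by simp
      then show ?thesis using h by blast
    qed
    have fg: "f 0 = v (\<gamma> a)" "f n = v (\<gamma> b)" "g 0 = v (\<gamma>' a')" "g m = v (\<gamma>' b')"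
      using ab nm by (simp_all add: f_def g_def min_absorb2)
    define i where "i = nat \<lfloor>s - a\<rfloor>"
    have i: "real i \<le> s - a" "s - a \<le> real i + 1" unfolding i_def using s by auto
    have "s - a \<le> b - a" using s by simp
    then have "i \<le> n" unfolding i_def n_def by (intro nat_mono) linarith
    have car: "f j \<in> carrier G" "g j \<in> carrier G" for j
      using v pts ab by (auto simp: f_def g_def)
    have "\<exists>j\<le>m. d (f i) (g j) \<le> L"
    proof (rule L)
      show "discrete_quasi_geodesic d (\<tau> + 3) n f"
        unfolding f_def n_def by (rule discretize_quasi_geodesic[OF S \<tau> ab(1) \<gamma> v])
      show "discrete_quasi_geodesic d (\<tau> + 3) m g"
        unfolding g_def m_def by (rule discretize_quasi_geodesic[OF S \<tau> ab(2) \<gamma>' v])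
      show "\<exists>h\<in>H. d (f 0) h \<le> 1" "\<exists>h\<in>H. d (f n) h \<le> 1"
        using near_end ends unfolding fg by auto
    qed (use car fg eq \<open>i \<le> n\<close> in auto)
    then obtain j where j: "d (f i) (g j) \<le> L" by blast
    define s' where "s' = min (a + real i) b"
    define t where "t = min (a' + real j) b'"
    have s't: "s' \<in> {a..b}" "t \<in> {a'..b'}" using ab by (auto simp: s'_def t_def)
    have "\<bar>s - s'\<bar> \<le> 1" using i s by (auto simp: s'_def)
    have "cayley_dist G S (\<gamma> s) (\<gamma> s') \<le> \<tau> * \<bar>s - s'\<bar> + \<tau>"
      using \<gamma> s s't unfolding quasi_geodesic_def by blast
    also have "\<dots> \<le> \<tau> * 1 + \<tau>"
      using \<open>\<bar>s - s'\<bar> \<le> 1\<close> \<tau> by (intro add_right_mono mult_left_mono) auto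
    finally have s_s': "cayley_dist G S (\<gamma> s) (\<gamma> s') \<le> 2 * \<tau>" by simp
    have fi: "f i = v (\<gamma> s')" "g j = v (\<gamma>' t)" by (auto simp: f_def g_def s'_def t_def)
    have P: "\<gamma> s \<in> cayley_points G S" "\<gamma> s' \<in> cayley_points G S" "\<gamma>' t \<in> cayley_points G S"
      "vertex_point (f i) \<in> cayley_points G S" "vertex_point (g j) \<in> cayley_points G S"
      using pts s s't vertex_point_mem_cayley_points[OF S] car by auto
    have "cayley_dist G S (\<gamma> s) (\<gamma>' t) \<le> cayley_dist G S (\<gamma> s) (\<gamma> s') + cayley_dist G S (\<gamma> s') (vertex_point (f i))
        + cayley_dist G S (vertex_point (f i)) (vertex_point (g j)) + cayley_dist G S (vertex_point (g j)) (\<gamma>' t)"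
      using cayley_dist_triangle[OF S P(1,2,3)] cayley_dist_triangle[OF S P(2,4,3)]
        cayley_dist_triangle[OF S P(4,5,3)] by linarith
    moreover have "cayley_dist G S (vertex_point (g j)) (\<gamma>' t) \<le> 1"
      using v[OF P(3)] cayley_dist_commute[OF S, of "\<gamma>' t"] fi by simp
    moreover have "cayley_dist G S (\<gamma> s') (vertex_point (f i)) \<le> 1" using v[OF P(2)] fi by simp
    moreover have "cayley_dist G S (vertex_point (f i)) (vertex_point (g j)) \<le> \<bar>L\<bar>"
      using j cayley_dist_vertices[OF S car] by simp
    ultimately have "cayley_dist G S (\<gamma> s) (\<gamma>' t) \<le> 2 * \<tau> + 2 + \<bar>L\<bar>"
      using s_s' by linarith
    then show ?thesis using s't by blast
  qed
  moreover have "0 \<le> 2 * \<tau> + 2 + \<bar>L\<bar>" using \<tau> by simp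
  ultimately show ?thesis by (rule that[rotated])
qed

theorem theorem1p5:
  fixes G :: "('g, 'm) monoid_scheme"
    and \<phi> :: "'g \<Rightarrow> 'x::metric_space \<Rightarrow> 'x"
    and H :: "'g set"
  assumes "AQI_triple G \<phi> H"
    and "finitely_generated G (carrier G)"
  shows "stable_subgroup G H"
  unfolding stable_subgroup_def
proof (intro conjI allI impI)
  have "group_action G UNIV \<phi>" using assms(1) by (auto simp: AQI_triple_def isometric_action_def)
  from group_action.group_hom[OF this] show "group G" by (simp add: group_hom_def)
  show "subgroup H G" "finitely_generated G H" using assms(1) by (auto simp: AQI_triple_def)
  show "undistorted G H" by (rule AQI_undistorted[OF assms(1)])
next
  fix S and \<tau> :: real assume S: "finite_generating_set G (carrier G) S" and \<tau>: "1 \<le> \<tau>"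
  obtain x A \<delta> where "quasi_isometric_orbit G \<phi> H S x A \<delta>"
    by (rule AQI_orbit[OF assms(1) S]) (rule that)
  then interpret quasi_isometric_orbit G \<phi> H S x A \<delta> .
  obtain L where "0 \<le> L" and L: "\<And>\<gamma> \<gamma>' a b a' b' s. a \<le> b \<Longrightarrow> a' \<le> b' \<Longrightarrow>
      quasi_geodesic (cayley_points G S) (cayley_dist G S) \<tau> {a..b} \<gamma> \<Longrightarrow>
      quasi_geodesic (cayley_points G S) (cayley_dist G S) \<tau> {a'..b'} \<gamma>' \<Longrightarrow>
      \<gamma> a = \<gamma>' a' \<Longrightarrow> \<gamma> b = \<gamma>' b' \<Longrightarrow> \<gamma> a \<in> vertex_point ` H \<Longrightarrow> \<gamma> b \<in> vertex_point ` H \<Longrightarrow>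
      s \<in> {a..b} \<Longrightarrow> \<exists>t\<in>{a'..b'}. cayley_dist G S (\<gamma> s) (\<gamma>' t) \<le> L"
    by (rule quasi_geodesics_close[OF \<tau>]) (rule that, assumption, blast)
  show "\<exists>L::real. \<forall>\<gamma>1 \<gamma>2 a1 b1 a2 b2.
          a1 \<le> b1 \<and> a2 \<le> b2 \<and>
          quasi_geodesic (cayley_points G S) (cayley_dist G S) \<tau> {a1..b1} \<gamma>1 \<and>
          quasi_geodesic (cayley_points G S) (cayley_dist G S) \<tau> {a2..b2} \<gamma>2 \<and>
          \<gamma>1 a1 = \<gamma>2 a2 \<and> \<gamma>1 b1 = \<gamma>2 b2 \<and>
          \<gamma>1 a1 \<in> vertex_point ` H \<and> \<gamma>1 b1 \<in> vertex_point ` H \<longrightarrow>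
          hausdorff_distance (cayley_dist G S) (\<gamma>1 ` {a1..b1}) (\<gamma>2 ` {a2..b2}) \<le> ereal L"
  proof (intro exI[of _ L] allI impI, elim conjE)
    fix \<gamma>1 \<gamma>2 :: "real \<Rightarrow> 'g \<Rightarrow> real" and a1 b1 a2 b2 :: real
    assume ab: "a1 \<le> b1" "a2 \<le> b2"
      and qg: "quasi_geodesic (cayley_points G S) (cayley_dist G S) \<tau> {a1..b1} \<gamma>1"
        "quasi_geodesic (cayley_points G S) (cayley_dist G S) \<tau> {a2..b2} \<gamma>2"
      and eq: "\<gamma>1 a1 = \<gamma>2 a2" "\<gamma>1 b1 = \<gamma>2 b2"
      and ends: "\<gamma>1 a1 \<in> vertex_point ` H" "\<gamma>1 b1 \<in> vertex_point ` H"
    show "hausdorff_distance (cayley_dist G S) (\<gamma>1 ` {a1..b1}) (\<gamma>2 ` {a2..b2}) \<le> ereal L"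
      unfolding hausdorff_distance_def
    \<comment> \<open>The one-sided estimate is symmetric in the two curves, so exchanging them
      shows that \<open>L\<close> itself is admissible in the infimum.\<close>
    proof (intro Inf_lower CollectI exI[of _ L] conjI ballI)
      fix p assume "p \<in> \<gamma>1 ` {a1..b1}"
      then show "\<exists>q\<in>\<gamma>2 ` {a2..b2}. cayley_dist G S p q \<le> L" using L[OF ab qg eq ends] by auto
    next
      fix q assume "q \<in> \<gamma>2 ` {a2..b2}"
      then show "\<exists>p\<in>\<gamma>1 ` {a1..b1}. cayley_dist G S q p \<le> L"
        using L[OF ab(2,1) qg(2,1) eq[symmetric]] ends eq by auto
    qed (simp_all add: \<open>0 \<le> L\<close>)
  qed
qed (rule assms(2))

end
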